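(* Let $\partial\Omega$ be tangent-cone graph-like with radius $r>0$ and let $s\in[0,L)$ be such that $\partial\Omega$ is tangentially graph-like at $\gamma(s)$ with radius $r$. Then $\frac{\partial}{\partial s}g(s,r)=h_2-h_1=r\sin(\theta_2)-r\sin(\theta_1)$.
   Context: $\Omega\subset\mathbb R^2$ is compact with simple closed, piecewise continuously differentiable boundary $\partial\Omega$ of length $L$; $\gamma:[0,L]\to\partial\Omega$ is a continuous counterclockwise arclength parameterization, $\gamma(0)=\gamma(L)$. $D(p,r)$ and $C(p,r)$ are the closed disk and circle of radius $r$ about $p$; $g(s,r)=\operatorname{Area}(\Omega\cap D(\gamma(s),r))$. Tangent cone: $T_\gamma(s)=\{\alpha\Gamma^-+\beta\Gamma^+:\alpha,\beta\ge0,\alpha+\beta>0\}$ with $\Gamma^\mp$ the left/right limits of $\gamma'$ at $s$ (periodic extension). $\partial\Omega$ is tangent-cone graph-like with radius $r$ if for every $p=\gamma(s)\in\partial\Omega$, every $w\in T_\gamma(s)$ and all distinct $u,v\in\partial\Omega\cap D(p,r)$, $\langle w,u-v\rangle\ne0$. $\partial\Omega$ is tangentially graph-like (TGL) at $p$ with radius $r$ if $\partial\Omega$ is continuously differentiable and there is a Cartesian coordinate system with origin $p$ in which $\partial\Omega\cap D(p,r)$ is the graph of a function $f$ with $f(0)=0$, $f'(0)=0$; coordinates are oriented so that the interior of $\Omega$ is "up", i.e. $(0,\epsilon)\in\Omega$ for small $\epsilon>0$. In these coordinates at $p=\gamma(s)$, $\partial\Omega$ meets $C(\gamma(s),r)$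 in exactly two points, one on the right (exit point) and one on the left (entry point); $\theta_1\in(-\frac\pi2,\frac\pi2)$ and $\theta_2\in(\frac\pi2,\frac{3\pi}2)$ are the angles with the positive $x$-axis of the rays from the origin to the right and left points, and $h_1$, $h_2$ are the $y$-coordinates (heights) of the right and left points respectively. *)

theory Defs
  imports "HOL-Complex_Analysis.Complex_Analysis"
begin

text \<open>The plane is identified with the type of complex numbers; its inner product and its
  Lebesgue measure are those of the Euclidean plane. A curve parameterized by \<open>[0, L]\<close> is a
  function on the reals of which only the values on \<open>{0..L}\<close> matter.\<close>

definition periodic_ext :: "real \<Rightarrow> (real \<Rightarrow> complex) \<Rightarrow> real \<Rightarrow> complex" where
  "periodic_ext L \<gamma> t = \<gamma> (L * frac (t / L))"

definition velocity :: "real \<Rightarrow> (real \<Rightarrow> complex) \<Rightarrow> real \<Rightarrow> complex" where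
  "velocity L \<gamma> t = vector_derivative (periodic_ext L \<gamma>) (at t)"

text \<open>The notion \<open>piecewise_C1_differentiable_on\<close> puts no condition on the derivative near the
  exceptional points. Here the derivative must also have one-sided limits everywhere, i.e. the
  curve is continuously differentiable on each closed piece up to the end points.\<close>

definition piecewise_C1_closed_curve :: "real \<Rightarrow> (real \<Rightarrow> complex) \<Rightarrow> bool" where
  "piecewise_C1_closed_curve L \<gamma> \<longleftrightarrow>
     \<gamma> piecewise_C1_differentiable_on {0..L} \<and> \<gamma> 0 = \<gamma> L \<and>
     (\<forall>t. (\<exists>l. (velocity L \<gamma> \<longlongrightarrow> l) (at_left t)) \<and>
          (\<exists>l. (velocity L \<gamma> \<longlongrightarrow> l) (at_right t)))"

text \<open>A piecewise continuously differentiable curve is parameterized by arclength iff it has unit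
  speed; in particular \<open>L\<close> below is the length of the boundary. The curve is reparameterized over
  \<open>[0, 1]\<close> to use the library's simple paths and winding numbers.\<close>

definition arclength_boundary :: "complex set \<Rightarrow> real \<Rightarrow> (real \<Rightarrow> complex) \<Rightarrow> bool" where
  "arclength_boundary \<Omega> L \<gamma> \<longleftrightarrow>
     L > 0 \<and> compact \<Omega> \<and> frontier \<Omega> = \<gamma> ` {0..L} \<and>
     piecewise_C1_closed_curve L \<gamma> \<and>
     simple_path (\<lambda>t. \<gamma> (L * t)) \<and>
     (\<forall>t\<in>{0..L}. \<forall>D. (\<gamma> has_vector_derivative D) (at t within {0..L}) \<longrightarrow> norm D = 1) \<and>
     (\<forall>z\<in>inside (frontier \<Omega>). winding_number (\<lambda>t. \<gamma> (L * t)) z = 1)"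

definition disk_area :: "complex set \<Rightarrow> real \<Rightarrow> (real \<Rightarrow> complex) \<Rightarrow> real \<Rightarrow> real \<Rightarrow> real" where
  "disk_area \<Omega> L \<gamma> s r = measure lebesgue (\<Omega> \<inter> cball (periodic_ext L \<gamma> s) r)"

definition tangent_cone :: "real \<Rightarrow> (real \<Rightarrow> complex) \<Rightarrow> real \<Rightarrow> complex set" where
  "tangent_cone L \<gamma> s =
     {\<alpha> *\<^sub>R Lim (at_left s) (velocity L \<gamma>) + \<beta> *\<^sub>R Lim (at_right s) (velocity L \<gamma>) | \<alpha> \<beta>.
        \<alpha> \<ge> 0 \<and> \<beta> \<ge> 0 \<and> \<alpha> + \<beta> > 0}"

definition tangent_cone_graph_like ::
    "complex set \<Rightarrow> real \<Rightarrow> (real \<Rightarrow> complex) \<Rightarrow> real \<Rightarrow> bool" where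
  "tangent_cone_graph_like \<Omega> L \<gamma> r \<longleftrightarrow>
     (\<forall>s\<in>{0..L}. \<forall>w\<in>tangent_cone L \<gamma> s.
        \<forall>u\<in>frontier \<Omega> \<inter> cball (\<gamma> s) r. \<forall>v\<in>frontier \<Omega> \<inter> cball (\<gamma> s) r.
          u \<noteq> v \<longrightarrow> inner w (u - v) \<noteq> 0)"

text \<open>The Cartesian coordinates \<open>(x, y)\<close> of \<open>q\<close>, written \<open>x + \<i> y\<close>, with origin \<open>p\<close> and unit vector
  \<open>e\<close> along the positive x-axis. The system is right-handed: the positive y-axis points along
  \<open>\<i> * e\<close>. (In a left-handed system the left and right points would be interchanged.)\<close>

definition coords :: "complex \<Rightarrow> complex \<Rightarrow> complex \<Rightarrow> complex" where
  "coords p e q = (q - p) / e"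

text \<open>The function \<open>f\<close> is a partial one with domain \<open>X\<close>; the condition \<open>f'(0) = 0\<close> presupposes that
  \<open>0\<close> is interior to the domain.\<close>

definition tangential_frame :: "complex set \<Rightarrow> complex \<Rightarrow> real \<Rightarrow> complex \<Rightarrow> bool" where
  "tangential_frame \<Omega> p r e \<longleftrightarrow>
     norm e = 1 \<and>
     (\<exists>X f. 0 \<in> interior X \<and> f 0 = 0 \<and> (f has_real_derivative 0) (at 0) \<and>
        coords p e ` (frontier \<Omega> \<inter> cball p r) = {Complex x (f x) | x. x \<in> X}) \<and>
     (\<forall>\<^sub>F \<epsilon> in at_right 0. \<exists>q\<in>\<Omega>. coords p e q = Complex 0 \<epsilon>)"

definition tangentially_graph_like ::
    "complex set \<Rightarrow> real \<Rightarrow> (real \<Rightarrow> complex) \<Rightarrow> complex \<Rightarrow> real \<Rightarrow> bool" where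
  "tangentially_graph_like \<Omega> L \<gamma> p r \<longleftrightarrow>
     periodic_ext L \<gamma> C1_differentiable_on UNIV \<and> (\<exists>e. tangential_frame \<Omega> p r e)"

definition right_point :: "complex set \<Rightarrow> complex \<Rightarrow> real \<Rightarrow> complex \<Rightarrow> complex" where
  "right_point \<Omega> p r e = (THE q. q \<in> frontier \<Omega> \<inter> sphere p r \<and> Re (coords p e q) > 0)"

definition left_point :: "complex set \<Rightarrow> complex \<Rightarrow> real \<Rightarrow> complex \<Rightarrow> complex" where
  "left_point \<Omega> p r e = (THE q. q \<in> frontier \<Omega> \<inter> sphere p r \<and> Re (coords p e q) < 0)"

definition right_height :: "complex set \<Rightarrow> complex \<Rightarrow> real \<Rightarrow> complex \<Rightarrow> real" where
  "right_height \<Omega> p r e = Im (coords p e (right_point \<Omega> p r e))"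

definition left_height :: "complex set \<Rightarrow> complex \<Rightarrow> real \<Rightarrow> complex \<Rightarrow> real" where
  "left_height \<Omega> p r e = Im (coords p e (left_point \<Omega> p r e))"

definition angle_in :: "real set \<Rightarrow> complex \<Rightarrow> real" where
  "angle_in I z = (THE \<theta>. \<theta> \<in> I \<and> z = rcis (norm z) \<theta>)"

definition right_angle :: "complex set \<Rightarrow> complex \<Rightarrow> real \<Rightarrow> complex \<Rightarrow> real" where
  "right_angle \<Omega> p r e = angle_in {- pi / 2 <..< pi / 2} (coords p e (right_point \<Omega> p r e))"

definition left_angle :: "complex set \<Rightarrow> complex \<Rightarrow> real \<Rightarrow> complex \<Rightarrow> real" where
  "left_angle \<Omega> p r e = angle_in {pi / 2 <..< 3 * pi / 2} (coords p e (left_point \<Omega> p r e))"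

end

theory Submission
  imports Defs
begin

text \<open>
  Moving the centre with velocity \<open>v\<close> changes the area at the rate of the integral of
  \<open>\<langle>n, v\<rangle>\<close> over the part of the circle inside \<open>\<Omega>\<close>, \<open>n\<close> being the outer normal. Since the area is
  Lipschitz in the centre, the boundary curve may be replaced by its tangent. In coordinates with
  the tangent as \<open>x\<close>-axis, slice the disk horizontally: dominated convergence differentiates the area
  under the integral over \<open>y\<close>, and the slice at height \<open>y\<close> contributes \<open>1\<close> at its right end point if
  that point lies in \<open>\<Omega>\<close>, minus the same at its left end point. The right half circle is inside
  \<open>\<Omega>\<close> exactly above \<open>h\<^sub>1\<close> and the left half circle exactly above \<open>h\<^sub>2\<close>, whence
  \<open>(r - h\<^sub>1) - (r - h\<^sub>2)\<close>.

  That the boundary meets the circle exactly once on either side follows from Rolle's theorem: by the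
  tangent cone condition the distance from \<open>p = \<gamma> s\<close> along the curve has no critical value in
  \<open>(0, r]\<close>. That the unit tangent \<open>\<gamma>' s\<close> points to the right when the interior is up is where the
  counterclockwise orientation enters: the winding number increases when the curve is crossed from
  its right to its left.
\<close>

unbundle no fps_syntax

subsection \<open>Areas in rotated coordinates and by slices\<close>

text \<open>A measure that gives every box its area is Lebesgue measure, and boxes correspond to
  boxes with the same sides. The product form opens the way to Fubini's theorem.\<close>

lemma distr_lborel_Complex:
  "distr (lborel :: (real \<times> real) measure) borel (\<lambda>(x, y). Complex x y) = lborel"
proof (rule lborel_eqI[symmetric])
  have m: "(\<lambda>(x, y). Complex x y) \<in> borel_measurable (borel :: (real \<times> real) measure)"
    by (intro borel_measurable_continuous_onI) (auto simp: case_prod_unfold Complex_eq intro!: continuous_intros)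
  fix l u :: complex
  assume le: "\<And>b. b \<in> Basis \<Longrightarrow> l \<bullet> b \<le> u \<bullet> b"
  have le': "Re l \<le> Re u" "Im l \<le> Im u"
    using le[of 1] le[of \<i>] by (auto simp: Basis_complex_def)
  have eq: "(\<lambda>(x, y). Complex x y) -` box l u = box (Re l, Im l) (Re u, Im u)"
    by (auto simp: box_def Basis_prod_def Basis_complex_def)
  have "emeasure (distr lborel borel (\<lambda>(x, y). Complex x y)) (box l u)
      = emeasure lborel (box (Re l, Im l) (Re u, Im u))"
    using m by (subst emeasure_distr) (auto simp: eq)
  also have "\<dots> = ennreal (\<Prod>b\<in>Basis. (u - l) \<bullet> b)"
    using le' by (subst emeasure_lborel_box) (auto simp: Basis_prod_def Basis_complex_def prod.union_disjoint)
  finally show "emeasure (distr lborel borel (\<lambda>(x, y). Complex x y)) (box l u)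
      = (\<Prod>b\<in>Basis. (u - l) \<bullet> b)" .
qed simp

text \<open>The detour through \<^typ>\<open>real^2\<close> gives access to the invariance of Lebesgue measure under
  orthogonal maps, which the library has for Cartesian powers only.\<close>

lemma distr_lborel_cart_Complex:
  "distr (lborel :: (real^2) measure) borel (\<lambda>x :: real^2. Complex (x $ 1) (x $ 2)) = lborel"
proof (rule lborel_eqI[symmetric])
  have m: "(\<lambda>x :: real^2. Complex (x $ 1) (x $ 2)) \<in> borel_measurable (borel :: (real^2) measure)"
    by (intro borel_measurable_continuous_onI) (auto simp: Complex_eq intro!: continuous_intros)
  fix l u :: complex
  assume le: "\<And>b. b \<in> Basis \<Longrightarrow> l \<bullet> b \<le> u \<bullet> b"
  have le': "Re l \<le> Re u" "Im l \<le> Im u"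
    using le[of 1] le[of \<i>] by (auto simp: Basis_complex_def)
  have eq: "(\<lambda>x :: real^2. Complex (x $ 1) (x $ 2)) -` box l u
      = box (vector [Re l, Im l] :: real^2) (vector [Re u, Im u])"
    by (auto simp: mem_box_cart forall_2 vector_2 in_box_complex_iff)
  have B: "(Basis :: (real^2) set) = {axis 1 1, axis 2 1}"
    by (auto simp: Basis_vec_def UNIV_2)
  have ne: "axis 1 1 \<noteq> (axis 2 1 :: real^2)"
    by (simp add: axis_eq_axis)
  have "emeasure (distr lborel borel (\<lambda>x :: real^2. Complex (x $ 1) (x $ 2))) (box l u)
      = emeasure lborel (box (vector [Re l, Im l] :: real^2) (vector [Re u, Im u]))"
    using m by (subst emeasure_distr) (auto simp: eq)
  also have "\<dots> = ennreal (\<Prod>b\<in>Basis. (u - l) \<bullet> b)"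
    using le' ne by (subst emeasure_lborel_box) (auto simp: B Basis_complex_def inner_axis)
  finally show "emeasure (distr lborel borel (\<lambda>x :: real^2. Complex (x $ 1) (x $ 2))) (box l u)
      = (\<Prod>b\<in>Basis. (u - l) \<bullet> b)" .
qed simp

text \<open>Multiplication by a unit complex number is linear and preserves norms, hence orthogonal
  once the plane is carried to \<open>real^2\<close>. Compactness survives all images and preimages
  involved and settles measurability.\<close>

lemma measure_rotation_complex:
  fixes e :: complex
  assumes e: "norm e = 1" and K: "compact K"
  shows "measure lborel ((\<lambda>z. e * z) ` K) = measure lborel K"
proof -
  define \<phi> :: "real^2 \<Rightarrow> complex" where "\<phi> x = Complex (x $ 1) (x $ 2)" for x
  \<comment> \<open>\<open>R\<close> is multiplication by \<open>e\<close>, conjugated by the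
    identification \<open>\<phi>\<close>.\<close>
  define R :: "real^2 \<Rightarrow> real^2"
    where "R x = vector [Re (e * \<phi> x), Im (e * \<phi> x)]" for x
  have cont: "continuous_on A \<phi>" for A
    unfolding \<phi>_def Complex_eq by (intro continuous_intros)
  have m: "\<phi> \<in> borel_measurable borel"
    using cont by (rule borel_measurable_continuous_onI)
  have meas: "measure lborel M = measure lborel (\<phi> -` M)" if "M \<in> sets borel" for M
  proof -
    have "measure (distr lborel borel \<phi>) M = measure lborel (\<phi> -` M)"
      using m that by (subst measure_distr) auto
    then show ?thesis
      using distr_lborel_cart_Complex by (simp add: \<phi>_def[abs_def])
  qed
  have \<phi>R: "\<phi> (R x) = e * \<phi> x" for x
    by (simp add: \<phi>_def R_def vector_2 complex_eq_iff algebra_simps)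
  have n: "norm (\<phi> x) = norm x" for x
    by (simp add: \<phi>_def cmod_def norm_vec_def L2_set_def sum_2)
  have bij: "\<phi> x = z \<longleftrightarrow> x = vector [Re z, Im z]" for x z
    by (auto simp: \<phi>_def vec_eq_iff forall_2 vector_2 complex_eq_iff)
  have lin: "linear R"
    by (rule linearI) (auto simp: R_def \<phi>_def vec_eq_iff forall_2 vector_2 algebra_simps)
  have orth: "orthogonal_transformation R"
    unfolding orthogonal_transformation using lin
    by (auto simp: n[symmetric] \<phi>R norm_mult e)
  have pre: "\<phi> -` ((\<lambda>z. e * z) ` K) = R ` (\<phi> -` K)"
  proof (intro equalityI subsetI)
    fix x assume "x \<in> \<phi> -` ((\<lambda>z. e * z) ` K)"
    then obtain z where z: "z \<in> K" "\<phi> x = e * z" by auto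
    define y :: "real^2" where "y = vector [Re z, Im z]"
    have "\<phi> y = z" by (simp add: bij y_def)
    then have "\<phi> (R y) = \<phi> x" using z by (simp add: \<phi>R)
    then have "x = R y" by (metis bij)
    with \<open>\<phi> y = z\<close> z show "x \<in> R ` (\<phi> -` K)" by auto
  qed (auto simp: \<phi>R)
  have "bounded K" using K by (rule compact_imp_bounded)
  then obtain B where B: "\<And>z. z \<in> K \<Longrightarrow> norm z \<le> B" by (auto simp: bounded_iff)
  have "bounded (\<phi> -` K)"
    using B by (auto simp: bounded_iff n[symmetric] intro!: exI[of _ B])
  moreover have "closed (\<phi> -` K)"
    using K cont[of UNIV] by (intro closed_vimage) (auto simp: compact_imp_closed continuous_on_eq_continuous_at)
  ultimately have c: "compact (\<phi> -` K)" by (simp add: compact_eq_bounded_closed)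
  have cK: "compact ((\<lambda>z. e * z) ` K)"
    using K by (intro compact_continuous_image continuous_intros)
  have c': "compact (R ` (\<phi> -` K))"
    using c lin by (intro compact_continuous_image linear_continuous_on) (auto simp: linear_conv_bounded_linear)
  have "measure lborel ((\<lambda>z. e * z) ` K) = measure lebesgue (R ` (\<phi> -` K))"
    using c' by (simp add: meas cK borel_compact pre measure_completion)
  also have "\<dots> = measure lebesgue (\<phi> -` K)"
    using orth c by (intro measure_orthogonal_image lmeasurable_compact)
  also have "\<dots> = measure lborel K"
    using c K by (simp add: meas borel_compact measure_completion)
  finally show ?thesis .
qed

text \<open>The frame at \<open>p\<close> along \<open>e\<close> arises from the standard one by a
  rotation and a translation. In pair form, slices parallel to \<open>e\<close> become sections of a
  subset of a product.\<close>

lemma measure_compact_frame: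
  fixes p e :: complex
  assumes e: "norm e = 1" and K: "compact K"
  shows "measure lborel K = measure lborel {(x, y). p + e * Complex x y \<in> K}"
proof -
  define M where "M = (\<lambda>q. inverse e * (q - p)) ` K"
  have cM: "compact M" unfolding M_def
    using K by (intro compact_continuous_image continuous_intros)
  have e0: "e \<noteq> 0" using e by auto
  have m: "(\<lambda>(x, y). Complex x y) \<in> borel_measurable (borel :: (real \<times> real) measure)"
    by (intro borel_measurable_continuous_onI) (auto simp: case_prod_unfold Complex_eq intro!: continuous_intros)
  have "measure lborel M = measure lborel ((\<lambda>z. e * z) ` M)"
    using e cM by (simp add: measure_rotation_complex)
  also have "(\<lambda>z. e * z) ` M = (+) (- p) ` K"
    using e0 by (auto simp: M_def image_image field_simps)
  also have "measure lborel \<dots> = measure lebesgue ((+) (- p) ` K)"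
    using K by (subst measure_completion) (auto intro!: borel_compact compact_translation_subtract)
  also have "\<dots> = measure lebesgue K"
    by (rule measure_translation)
  also have "\<dots> = measure lborel K"
    using K by (simp add: borel_compact measure_completion)
  finally have "measure lborel K = measure lborel M" ..
  also have "\<dots> = measure (distr (lborel :: (real \<times> real) measure) borel (\<lambda>(x, y). Complex x y)) M"
    by (simp add: distr_lborel_Complex)
  also have "\<dots> = measure lborel ((\<lambda>(x, y). Complex x y) -` M)"
    using m cM by (subst measure_distr) (auto simp: borel_compact)
  also have "(\<lambda>(x, y). Complex x y) -` M = {(x, y). p + e * Complex x y \<in> K}"
    using e0 by (force simp: M_def field_simps image_iff)
  finally show ?thesis .
qed

section \<open>Compact subsets of the line cut by a moving interval\<close>

lemma measure_Int_Icc_eq_integral: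
  fixes S :: "real set"
  assumes "compact S"
  shows "measure lborel (S \<inter> {a..b}) = integral {a..b} (indicator S)"
    and "(indicator S :: real \<Rightarrow> real) integrable_on {a..b}"
proof -
  have c: "compact (S \<inter> {a..b})" using assms by (intro compact_Int) auto
  then have "(indicator (S \<inter> {a..b}) has_integral measure lebesgue (S \<inter> {a..b})) UNIV"
    by (simp add: lmeasurable_compact flip: lmeasurable_iff_has_integral)
  also have "measure lebesgue (S \<inter> {a..b}) = measure lborel (S \<inter> {a..b})"
    using c by (intro measure_completion) (simp add: borel_compact)
  also have "indicator (S \<inter> {a..b}) = (\<lambda>x. if x \<in> {a..b} then indicator S x else 0 :: real)"
    by (auto simp: indicator_def)
  finally have "(indicator S has_integral measure lborel (S \<inter> {a..b})) {a..b}"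
    by (simp only: has_integral_restrict_UNIV)
  then show "measure lborel (S \<inter> {a..b}) = integral {a..b} (indicator S)"
    and "(indicator S :: real \<Rightarrow> real) integrable_on {a..b}"
    by (auto simp: integral_unique)
qed

text \<open>The primitive of an indicator is nondecreasing and 1-Lipschitz, because the integrand
  lies between 0 and 1.\<close>

lemma measure_Int_interval_diff:
  fixes S :: "real set"
  assumes S: "compact S" and ab: "a \<le> u" "u \<le> v"
  shows "measure lborel (S \<inter> {a..v}) - measure lborel (S \<inter> {a..u}) \<in> {0..v - u}"
proof -
  have i: "(indicator S :: real \<Rightarrow> real) integrable_on {x..y}" for x y :: real
    by (rule measure_Int_Icc_eq_integral(2)[OF S])
  have "integral {a..u} (indicator S) + integral {u..v} (indicator S) = integral {a..v} (indicator S :: real \<Rightarrow> real)"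
    using ab i by (intro Henstock_Kurzweil_Integration.integral_combine)
  then have "measure lborel (S \<inter> {a..v}) - measure lborel (S \<inter> {a..u}) = integral {u..v} (indicator S)"
    by (simp add: measure_Int_Icc_eq_integral[OF S])
  moreover have "0 \<le> integral {u..v} (indicator S :: real \<Rightarrow> real)"
    by (intro Henstock_Kurzweil_Integration.integral_nonneg i) simp
  moreover have "integral {u..v} (indicator S :: real \<Rightarrow> real) \<le> integral {u..v} (\<lambda>_. 1)"
    by (intro integral_le i) (auto simp: indicator_def)
  ultimately show ?thesis using ab by simp
qed

text \<open>Both moving end points are read off one primitive with fixed base point
  \<open>a\<close>, so that bounds and derivatives can be applied at each end separately.\<close>

lemma measure_Int_moving_interval:
  fixes S :: "real set"
  assumes S: "compact S" and w: "0 \<le> w" and a: "a \<le> h - w"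
  shows "measure lborel (S \<inter> {h - w..h + w}) =
    measure lborel (S \<inter> {a..h + w}) - measure lborel (S \<inter> {a..h - w})"
proof -
  have i: "(indicator S :: real \<Rightarrow> real) integrable_on {x..y}" for x y :: real
    by (rule measure_Int_Icc_eq_integral(2)[OF S])
  have "integral {a..h - w} (indicator S) + integral {h - w..h + w} (indicator S)
      = integral {a..h + w} (indicator S :: real \<Rightarrow> real)"
    using w a i by (intro Henstock_Kurzweil_Integration.integral_combine) auto
  then show ?thesis
    by (simp add: measure_Int_Icc_eq_integral[OF S])
qed

text \<open>Each end point moves by \<open>\<bar>h\<bar>\<close> and the primitive is 1-Lipschitz.
  The bound does not depend on \<open>S\<close> or \<open>w\<close>, which lets it dominate the
  difference quotients of all slices at once.\<close>

lemma measure_Int_moving_interval_lipschitz: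
  fixes S :: "real set"
  assumes S: "compact S" and w: "0 \<le> w"
  shows "\<bar>measure lborel (S \<inter> {h - w..h + w}) - measure lborel (S \<inter> {- w..w})\<bar> \<le> 2 * \<bar>h\<bar>"
proof -
  \<comment> \<open>This base point is to the left of both \<open>- w\<close> and
    \<open>h - w\<close>.\<close>
  define a where "a = - w - \<bar>h\<bar>"
  define F where "F u = measure lborel (S \<inter> {a..u})" for u
  have F: "\<bar>F u - F v\<bar> \<le> \<bar>u - v\<bar>" if "a \<le> u" "a \<le> v" for u v
    using measure_Int_interval_diff[OF S, of a u v] measure_Int_interval_diff[OF S, of a v u] that
    by (cases "u \<le> v") (auto simp: F_def)
  have "measure lborel (S \<inter> {h - w..h + w}) = F (h + w) - F (h - w)"
    using measure_Int_moving_interval[OF S w, of a h] by (simp add: F_def a_def)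
  moreover have "measure lborel (S \<inter> {- w..w}) = F w - F (- w)"
    using measure_Int_moving_interval[OF S w, of a 0] by (simp add: F_def a_def)
  moreover have "\<bar>F (h + w) - F w\<bar> \<le> \<bar>h\<bar>" "\<bar>F (h - w) - F (- w)\<bar> \<le> \<bar>h\<bar>"
    using F[of "h + w" w] F[of "h - w" "- w"] w by (auto simp: a_def)
  ultimately show ?thesis by linarith
qed

text \<open>Off the frontier the indicator is continuous, so the fundamental theorem of calculus
  applies.\<close>

lemma measure_Int_interval_deriv:
  fixes S :: "real set"
  assumes S: "compact S" and u: "a < u" and fr: "u \<notin> frontier S"
  shows "((\<lambda>u. measure lborel (S \<inter> {a..u})) has_real_derivative indicator S u) (at u)"
proof -
  have "continuous (at u) (indicator S :: real \<Rightarrow> real)"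
    using fr by (simp add: continuous_at_imp_continuous_at_within isCont_indicator)
  then have "((\<lambda>u. integral {a..u} (indicator S :: real \<Rightarrow> real)) has_vector_derivative indicator S u)
      (at u within ({a..u + 1} - {}))"
    using u measure_Int_Icc_eq_integral(2)[OF S]
    by (intro integral_has_vector_derivative_continuous_at) (auto intro: continuous_at_imp_continuous_at_within)
  moreover have "at u within {a..u + 1} = at u"
    using u by (intro at_within_interior) auto
  ultimately show ?thesis
    by (simp add: measure_Int_Icc_eq_integral(1)[OF S] has_real_derivative_iff_has_vector_derivative)
qed

lemma measure_Int_moving_interval_deriv:
  fixes S :: "real set"
  assumes S: "compact S" and w: "0 < w" and fr: "w \<notin> frontier S" "- w \<notin> frontier S"
  shows "((\<lambda>h. measure lborel (S \<inter> {h - w..h + w})) has_real_derivative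
     indicator S w - indicator S (- w)) (at 0)"
proof -
  \<comment> \<open>The margin 1 keeps the base point to the left of \<open>h - w\<close> whenever
    \<open>\<bar>h\<bar> < 1\<close>.\<close>
  define F where "F u = measure lborel (S \<inter> {-w - 1..u})" for u
  have "(F has_real_derivative indicator S w) (at (0 + w))"
    "(F has_real_derivative indicator S (- w)) (at (0 - w))"
    unfolding F_def using assms measure_Int_interval_deriv[OF S] by auto
  then have "((\<lambda>h. F (h + w) - F (h - w)) has_real_derivative indicator S w - indicator S (- w)) (at 0)"
    by (auto intro!: derivative_eq_intros DERIV_chain2[of F])
  then show ?thesis
  proof (rule has_field_derivative_transform_within[where d = 1])
    fix h :: real assume "dist h 0 < 1"
    then show "F (h + w) - F (h - w) = measure lborel (S \<inter> {h - w..h + w})"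
      using measure_Int_moving_interval[OF S, of w "- w - 1" h] w by (simp add: F_def)
  qed auto
qed

section \<open>Area by slices, and its dependence on the centre of the disk\<close>

lemma measure_compact_slices:
  fixes K :: "(real \<times> real) set"
  assumes "compact K"
  shows "integrable lborel (\<lambda>y. measure lborel {x. (x, y) \<in> K})"
    and "measure lborel K = (LINT y|lborel. measure lborel {x. (x, y) \<in> K})"
proof -
  have fin: "emeasure lborel K < \<infinity>"
    using assms by (intro emeasure_compact_finite)
  have m: "K \<in> sets borel" using assms by (rule borel_compact)
  have int: "integrable (lborel \<Otimes>\<^sub>M lborel) (\<lambda>(x, y). indicator K (x, y) :: real)"
    using fin m by (simp add: lborel_prod case_prod_unfold)
  have sec: "(LINT x|lborel. indicator K (x, y)) = measure lborel {x. (x, y) \<in> K}" for y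
  proof -
    have "(\<lambda>x. indicator K (x, y) :: real) = indicator {x. (x, y) \<in> K}"
      by (auto simp: indicator_def)
    then show ?thesis by simp
  qed
  show "integrable lborel (\<lambda>y. measure lborel {x. (x, y) \<in> K})"
    using lborel_pair.integrable_snd[OF int] by (simp add: sec)
  have "measure lborel K = (LINT z|(lborel \<Otimes>\<^sub>M lborel). (\<lambda>(x, y). indicator K (x, y)) z)"
    by (simp add: lborel_prod case_prod_unfold)
  also have "\<dots> = (LINT y|lborel. LINT x|lborel. indicator K (x, y))"
    using lborel_pair.integral_snd[OF int] by simp
  finally show "measure lborel K = (LINT y|lborel. measure lborel {x. (x, y) \<in> K})"
    by (simp add: sec)
qed

text \<open>With \<open>d = dist P Q\<close>, the part of the disk about \<open>P\<close> outside
  the disk about \<open>Q\<close> lies in an annulus of width \<open>d\<close>, whose area is at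
  most \<open>2 * pi * r * d\<close>. If \<open>d\<close> exceeds \<open>r\<close>, the area of a
  whole disk is already below the bound.\<close>

lemma measure_Int_cball_diff_le:
  fixes \<Omega> :: "complex set"
  assumes \<Omega>: "compact \<Omega>" and r: "0 < r"
  shows "\<bar>measure lborel (\<Omega> \<inter> cball P r) - measure lborel (\<Omega> \<inter> cball Q r)\<bar> \<le> 2 * pi * r * dist P Q"
proof -
  have 1: "measure lborel (\<Omega> \<inter> cball P r) - measure lborel (\<Omega> \<inter> cball Q r) \<le> 2 * pi * r * dist P Q" for P Q
  proof (cases "dist P Q \<le> r")
    case True
    define d where "d = dist P Q"
    have d: "0 \<le> d" "d \<le> r" using True by (auto simp: d_def)
    have sub: "cball P (r - d) \<subseteq> cball Q r" "cball P (r - d) \<subseteq> cball P r"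
      by (auto simp: d_def subset_iff) (smt (verit) dist_commute dist_triangle)+
    have "measure lborel (\<Omega> \<inter> cball P r) \<le> measure lborel ((\<Omega> \<inter> cball Q r) \<union> (cball P r - cball P (r - d)))"
      using \<Omega> sub by (intro measure_mono_fmeasurable) (auto intro!: fmeasurable.Un fmeasurable.Diff borel_compact compact_Int simp: fmeasurable_compact)
    also have "\<dots> \<le> measure lborel (\<Omega> \<inter> cball Q r) + measure lborel (cball P r - cball P (r - d))"
      using \<Omega> by (intro measure_Un_le) (auto intro!: borel_compact compact_Int)
    also have "measure lborel (cball P r - cball P (r - d)) = measure lborel (cball P r) - measure lborel (cball P (r - d))"
      using sub by (intro measurable_measure_Diff) (auto simp: fmeasurable_compact)
    also have "\<dots> = pi * (r\<^sup>2 - (r - d)\<^sup>2)"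
      using r d by (simp add: content_cball unit_ball_vol_2 algebra_simps)
    also have "\<dots> \<le> pi * (2 * r * d)"
      by (intro mult_left_mono) (auto simp: power2_eq_square algebra_simps)
    finally show ?thesis by (simp add: d_def)
  next
    case False
    have "measure lborel (\<Omega> \<inter> cball P r) \<le> measure lborel (cball P r)"
      using \<Omega> by (intro measure_mono_fmeasurable) (auto intro!: borel_compact compact_Int simp: fmeasurable_compact)
    also have "\<dots> = pi * r * r"
      using r by (simp add: content_cball unit_ball_vol_2 power2_eq_square)
    also have "\<dots> \<le> pi * r * dist P Q"
      using False r by (intro mult_left_mono) auto
    also have "\<dots> \<le> 2 * pi * r * dist P Q"
      using r by simp
    finally show ?thesis by (smt (verit) measure_nonneg)
  qed
  show ?thesis using 1[of P Q] 1[of Q P] by (simp add: dist_commute abs_le_iff)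
qed

text \<open>At each height the disk is an interval whose two ends move with speed one, so the slice
  length changes at the rate of the difference of the indicators at the ends, unless an end lies on
  the frontier. The heights in \<open>N\<close>, where this may happen, form a null set.\<close>

lemma disc_area_directional_deriv:
  fixes \<Omega> N and p e :: complex and r :: real
  assumes \<Omega>: "compact \<Omega>" and e: "norm e = 1" and r: "0 < r" and N: "finite N"
    and fr: "\<And>x y. \<lbrakk>\<bar>y\<bar> < r; y \<notin> N; x\<^sup>2 + y\<^sup>2 = r\<^sup>2\<rbrakk> \<Longrightarrow> p + e * Complex x y \<notin> frontier \<Omega>"
  shows "((\<lambda>h. measure lborel (\<Omega> \<inter> cball (p + of_real h * e) r)) has_real_derivative
      (LINT y|lborel. indicator {-r<..<r} y *
         (indicator \<Omega> (p + e * Complex (sqrt (r\<^sup>2 - y\<^sup>2)) y)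
          - indicator \<Omega> (p + e * Complex (- sqrt (r\<^sup>2 - y\<^sup>2)) y)))) (at 0)"
    (is "(?A has_real_derivative (LINT y|lborel. ?f y)) _")
proof -
  define w where "w y = sqrt (r\<^sup>2 - y\<^sup>2)" for y
  define S where "S y = {x. p + e * Complex x y \<in> \<Omega>}" for y
  \<comment> \<open>The frame stays at \<open>p\<close> for all \<open>h\<close> and only the disk
    moves; hence the slice \<open>S y\<close> does not depend on \<open>h\<close>.\<close>
  define K where "K h = {(x, y). p + e * Complex x y \<in> \<Omega> \<inter> cball (p + of_real h * e) r}" for h
  define m where "m h y = measure lborel {x. (x, y) \<in> K h}" for h y
  have e0: "e \<noteq> 0" using e by auto
  have compS: "compact (S y)" for y
  proof -
    have "S y = (\<lambda>z. Re ((z - p) / e)) ` (\<Omega> \<inter> {z. Im ((z - p) / e) = y})"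
    proof (intro equalityI subsetI)
      fix x assume "x \<in> S y"
      then show "x \<in> (\<lambda>z. Re ((z - p) / e)) ` (\<Omega> \<inter> {z. Im ((z - p) / e) = y})"
        using e0 by (intro image_eqI[of _ _ "p + e * Complex x y"]) (auto simp: S_def)
    next
      fix x assume "x \<in> (\<lambda>z. Re ((z - p) / e)) ` (\<Omega> \<inter> {z. Im ((z - p) / e) = y})"
      then obtain z where z: "z \<in> \<Omega>" "Complex x y = (z - p) / e"
        by (auto simp: complex_eq_iff)
      then have "p + e * Complex x y = z" using e0 by simp
      with z show "x \<in> S y" by (simp add: S_def)
    qed
    moreover have "closed {z. Im ((z - p) / e) = y}"
      by (intro closed_Collect_eq continuous_intros) (use e0 in auto)
    ultimately show ?thesis
      using \<Omega> e0 by (auto intro!: compact_continuous_image compact_Int_closed continuous_intros)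
  qed
  have compK: "compact (K h)" for h
  proof -
    have "K h = (\<lambda>z. (Re ((z - p) / e), Im ((z - p) / e))) ` (\<Omega> \<inter> cball (p + of_real h * e) r)"
    proof (intro equalityI subsetI)
      fix q assume "q \<in> K h"
      then show "q \<in> (\<lambda>z. (Re ((z - p) / e), Im ((z - p) / e))) ` (\<Omega> \<inter> cball (p + of_real h * e) r)"
        using e0 by (intro image_eqI[of _ _ "p + e * Complex (fst q) (snd q)"]) (auto simp: K_def)
    next
      fix q assume "q \<in> (\<lambda>z. (Re ((z - p) / e), Im ((z - p) / e))) ` (\<Omega> \<inter> cball (p + of_real h * e) r)"
      then obtain z where z: "z \<in> \<Omega> \<inter> cball (p + of_real h * e) r"
        "Complex (fst q) (snd q) = (z - p) / e"
        by (auto simp: complex_eq_iff)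
      then have "p + e * Complex (fst q) (snd q) = z" using e0 by simp
      with z(1) have "p + e * Complex (fst q) (snd q) \<in> \<Omega> \<inter> cball (p + of_real h * e) r" by (simp only:)
      then show "q \<in> K h" by (simp only: K_def case_prod_unfold mem_Collect_eq)
    qed
    then show ?thesis
      using \<Omega> e0 by (auto intro!: compact_continuous_image compact_Int continuous_intros)
  qed
  have mint: "integrable lborel (m h)" for h
    using measure_compact_slices(1)[OF compK, of h] by (simp add: m_def[abs_def])
  have A: "?A h = (LINT y|lborel. m h y)" for h
    using measure_compact_slices(2)[OF compK, of h] \<Omega>
      measure_compact_frame[OF e, of "\<Omega> \<inter> cball (p + of_real h * e) r" p]
    unfolding m_def K_def by (simp add: compact_Int)
  have ball_iff: "p + e * Complex x y \<in> cball (p + of_real h * e) r \<longleftrightarrow> (x - h)\<^sup>2 + y\<^sup>2 \<le> r\<^sup>2" for x y h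
  proof -
    have "dist (p + of_real h * e) (p + e * Complex x y) = norm (e * Complex (x - h) y)"
      unfolding dist_norm by (subst norm_minus_commute, rule arg_cong[of _ _ norm])
        (simp add: complex_eq_iff algebra_simps)
    also have "\<dots> = sqrt ((x - h)\<^sup>2 + y\<^sup>2)" by (simp only: norm_mult e) (simp add: cmod_def)
    finally have "p + e * Complex x y \<in> cball (p + of_real h * e) r \<longleftrightarrow> sqrt ((x - h)\<^sup>2 + y\<^sup>2) \<le> sqrt (r\<^sup>2)"
      using r by simp
    then show ?thesis by (simp only: real_sqrt_le_iff)
  qed
  have K_iff: "(x, y) \<in> K h \<longleftrightarrow> x \<in> S y \<and> (x - h)\<^sup>2 + y\<^sup>2 \<le> r\<^sup>2" for x y h
    by (simp only: K_def S_def mem_Collect_eq case_prod_conv Int_iff ball_iff)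
  have slice: "{x. (x, y) \<in> K h} = S y \<inter> {h - w y..h + w y}" if "\<bar>y\<bar> \<le> r" for h y
  proof -
    have *: "(x - h)\<^sup>2 + y\<^sup>2 \<le> r\<^sup>2 \<longleftrightarrow> \<bar>x - h\<bar> \<le> w y" for x
    proof -
      have "\<bar>x - h\<bar> \<le> w y \<longleftrightarrow> sqrt ((x - h)\<^sup>2) \<le> sqrt (r\<^sup>2 - y\<^sup>2)" by (simp add: w_def)
      also have "\<dots> \<longleftrightarrow> (x - h)\<^sup>2 \<le> r\<^sup>2 - y\<^sup>2" by (rule real_sqrt_le_iff)
      finally show ?thesis by auto
    qed
    show ?thesis
      unfolding set_eq_iff mem_Collect_eq K_iff * Int_iff atLeastAtMost_iff by (auto simp: abs_le_iff)
  qed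
  have slice0: "m h y = 0" if "r < \<bar>y\<bar>" for h y
  proof -
    have "r\<^sup>2 < y\<^sup>2" using power_strict_mono[of r "\<bar>y\<bar>" 2] that r by simp
    then have "\<not> (x - h)\<^sup>2 + y\<^sup>2 \<le> r\<^sup>2" for x
      by (smt (verit) zero_le_power2)
    then have "{x. (x, y) \<in> K h} = {}" by (auto simp: K_iff)
    then show ?thesis by (simp add: m_def)
  qed
  have w0: "0 \<le> w y" if "\<bar>y\<bar> \<le> r" for y
    using that abs_le_square_iff[of y r] r by (simp add: w_def)
  have bound: "\<bar>(m h y - m 0 y) / h\<bar> \<le> 2 * indicator {- r..r} y" for h y
  proof (cases "\<bar>y\<bar> \<le> r")
    case True
    then have "\<bar>m h y - m 0 y\<bar> \<le> 2 * \<bar>h\<bar>"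
      using measure_Int_moving_interval_lipschitz[OF compS[of y] w0[of y], of h] by (simp add: m_def slice)
    then have "\<bar>m h y - m 0 y\<bar> / \<bar>h\<bar> \<le> 2"
      by (cases "h = 0") (auto simp: divide_le_eq)
    then show ?thesis using True by (simp add: abs_divide abs_le_iff[of y] indicator_def)
  qed (auto simp: slice0)
  have lim: "((\<lambda>h. (m h y - m 0 y) / h) \<longlongrightarrow> ?f y) (at 0)"
    if y: "\<bar>y\<bar> \<noteq> r" "y \<notin> N" for y
  proof (cases "\<bar>y\<bar> < r")
    case True
    then have lt: "y\<^sup>2 < r\<^sup>2" using power_strict_mono[of "\<bar>y\<bar>" r 2] by simp
    then have w: "0 < w y" by (simp add: w_def)
    have w2: "(w y)\<^sup>2 + y\<^sup>2 = r\<^sup>2" using lt by (simp add: w_def)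
    \<comment> \<open>The frontier of the slice is handled through indicators: that of
      \<open>\<Omega>\<close> is continuous at the point by \<open>fr\<close>, and its composition
      with the horizontal line is the indicator of \<open>S y\<close>.\<close>
    have nf: "x \<notin> frontier (S y)" if "x\<^sup>2 + y\<^sup>2 = r\<^sup>2" for x
    proof -
      have "continuous_on UNIV (\<lambda>x. p + e * Complex x y)"
        unfolding Complex_eq by (intro continuous_intros)
      then have c: "isCont (\<lambda>x. p + e * Complex x y) x"
        by (simp add: continuous_on_eq_continuous_at)
      have "isCont (indicator \<Omega> :: complex \<Rightarrow> real) (p + e * Complex x y)"
        using fr[OF True y(2) that] by (simp add: isCont_indicator)
      from isCont_o2[OF c this] have "isCont (\<lambda>x. indicator \<Omega> (p + e * Complex x y) :: real) x" .
      also have "(\<lambda>x. indicator \<Omega> (p + e * Complex x y) :: real) = indicator (S y)"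
        by (auto simp: S_def indicator_def)
      finally show ?thesis by (simp add: isCont_indicator)
    qed
    have "((\<lambda>h. m h y) has_real_derivative indicator (S y) (w y) - indicator (S y) (- w y)) (at 0)"
      using measure_Int_moving_interval_deriv[OF compS w nf nf] w2 True by (simp add: m_def slice)
    then show ?thesis
      using True by (simp add: has_field_derivative_iff S_def w_def indicator_def abs_less_iff minus_less_iff)
  next
    case False
    then have "r < \<bar>y\<bar>" "y \<notin> {- r<..<r}" using y by auto
    then show ?thesis by (simp add: slice0)
  qed
  have meas_f: "?f \<in> borel_measurable lborel"
  proof -
    have "closed \<Omega>" using \<Omega> by (rule compact_imp_closed)
    then have ind: "(indicator \<Omega> :: complex \<Rightarrow> real) \<in> borel_measurable borel"
      by (intro borel_measurable_indicator borel_closed)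
    have "(\<lambda>y. p + e * Complex (sqrt (r\<^sup>2 - y\<^sup>2)) y) \<in> borel_measurable borel"
      "(\<lambda>y. p + e * Complex (- sqrt (r\<^sup>2 - y\<^sup>2)) y) \<in> borel_measurable borel"
      unfolding Complex_eq by (intro borel_measurable_continuous_onI continuous_intros)+
    from this[THEN measurable_compose, OF ind]
    have "?f \<in> borel_measurable borel"
      by (intro borel_measurable_times borel_measurable_diff borel_measurable_indicator) auto
    then show ?thesis by simp
  qed
  \<comment> \<open>Dominated convergence speaks of sequences, so the limit is tested along
    sequences of nonzero displacements.\<close>
  show ?thesis
    unfolding has_field_derivative_iff tendsto_at_iff_sequentially
  proof (intro allI impI)
    fix X :: "nat \<Rightarrow> real"
    assume X: "\<forall>i. X i \<in> UNIV - {0}" and X0: "X \<longlonglongrightarrow> 0"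
    have "(\<lambda>i. LINT y|lborel. (m (X i) y - m 0 y) / X i) \<longlonglongrightarrow> (LINT y|lborel. ?f y)"
    proof (rule integral_dominated_convergence[where w = "\<lambda>y. 2 * indicator {- r..r} y"])
      show "integrable lborel (\<lambda>y. 2 * indicator {- r..r} y :: real)"
        by (intro integrable_mult_right integrable_real_indicator) (auto simp: emeasure_lborel_Icc_eq)
      show "AE y in lborel. (\<lambda>i. (m (X i) y - m 0 y) / X i) \<longlonglongrightarrow> ?f y"
      proof (rule AE_I')
        \<comment> \<open>The heights \<open>r\<close> and \<open>- r\<close> are left out because
          the interval has half-width zero there.\<close>
        show "insert r (insert (- r) N) \<in> null_sets lborel"
          using N by (intro finite_imp_null_set_lborel) auto
        have "(\<lambda>i. (m (X i) y - m 0 y) / X i) \<longlonglongrightarrow> ?f y" if "y \<notin> insert r (insert (- r) N)" for y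
        proof -
          have "\<bar>y\<bar> \<noteq> r" "y \<notin> N" using that by auto
          from lim[OF this] X X0 show ?thesis
            unfolding tendsto_at_iff_sequentially by (auto simp: o_def)
        qed
        then show "{y \<in> space lborel. \<not> (\<lambda>i. (m (X i) y - m 0 y) / X i) \<longlonglongrightarrow> ?f y} \<subseteq> insert r (insert (- r) N)"
          by blast
      qed
      show "AE y in lborel. norm ((m (X i) y - m 0 y) / X i) \<le> 2 * indicator {- r..r} y" for i
        using bound by simp
      show "(\<lambda>y. (m (X i) y - m 0 y) / X i) \<in> borel_measurable lborel" for i
        by (intro borel_measurable_divide borel_measurable_diff borel_measurable_integrable mint borel_measurable_const)
    qed (rule meas_f)
    moreover have "(LINT y|lborel. (m (X i) y - m 0 y) / X i) = (?A (X i) - ?A 0) / (X i - 0)" for i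
      unfolding A by (simp add: mint)
    ultimately show "((\<lambda>h. (?A h - ?A 0) / (h - 0)) \<circ> X) \<longlonglongrightarrow> (LINT y|lborel. ?f y)"
      by (simp only: o_def)
  qed
qed

text \<open>Curve and tangent line differ by o(t - s) and the area is Lipschitz in the centre, so
  both motions of the disk give the same derivative.\<close>

lemma disc_area_curve_deriv:
  fixes \<Omega> and c :: "real \<Rightarrow> complex" and e :: complex and r :: real
  assumes \<Omega>: "compact \<Omega>" and r: "0 < r" and c: "(c has_vector_derivative e) (at s)"
    and D: "((\<lambda>h. measure lborel (\<Omega> \<inter> cball (c s + of_real h * e) r)) has_real_derivative D) (at 0)"
  shows "((\<lambda>t. measure lborel (\<Omega> \<inter> cball (c t) r)) has_real_derivative D) (at s)"
proof -
  define A where "A q = measure lborel (\<Omega> \<inter> cball q r)" for q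
  define R where "R t = (A (c t) - A (c s + of_real (t - s) * e)) / (t - s)" for t
  have "((\<lambda>t. norm (c t - c s - (t - s) *\<^sub>R e) / norm (t - s)) \<longlongrightarrow> 0) (at s)"
    using c by (simp add: has_vector_derivative_def has_derivative_iff_norm)
  then have lim: "((\<lambda>t. 2 * pi * r * (norm (c t - c s - (t - s) *\<^sub>R e) / norm (t - s))) \<longlongrightarrow> 0) (at s)"
    by (rule tendsto_mult_right_zero)
  have "\<bar>R t\<bar> \<le> 2 * pi * r * (norm (c t - c s - (t - s) *\<^sub>R e) / norm (t - s))" for t
  proof -
    have "\<bar>A (c t) - A (c s + of_real (t - s) * e)\<bar> \<le> 2 * pi * r * dist (c t) (c s + of_real (t - s) * e)"
      unfolding A_def by (rule measure_Int_cball_diff_le[OF \<Omega> r])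
    also have "dist (c t) (c s + of_real (t - s) * e) = norm (c t - c s - (t - s) *\<^sub>R e)"
      by (simp add: dist_norm scaleR_conv_of_real algebra_simps)
    finally show ?thesis
      by (auto simp: R_def abs_divide divide_right_mono)
  qed
  then have R0: "(R \<longlongrightarrow> 0) (at s)"
    by (intro Lim_null_comparison[OF _ lim] always_eventually) auto
  have "((\<lambda>h. (A (c s + of_real h * e) - A (c s)) / h) \<longlongrightarrow> D) (at 0)"
    using D by (simp add: A_def has_field_derivative_iff)
  then have "((\<lambda>t. (A (c s + of_real (t - s) * e) - A (c s)) / (t - s)) \<longlongrightarrow> D) (at s)"
    by - (rule LIM_offset_zero_cancel, simp)
  from tendsto_add[OF R0 this] show ?thesis
    unfolding has_field_derivative_iff A_def[symmetric]
    by (simp add: R_def add_divide_distrib[symmetric])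
qed

text \<open>Up to two points the integrand is the difference of the indicators of the intervals from
  \<open>h1\<close> to \<open>r\<close> and from \<open>h2\<close> to \<open>r\<close>.\<close>

lemma integral_step_difference:
  fixes a b :: "real \<Rightarrow> real"
  assumes h: "\<bar>h1\<bar> < r" "\<bar>h2\<bar> < r"
    and a: "\<And>y. \<lbrakk>\<bar>y\<bar> < r; h1 < y\<rbrakk> \<Longrightarrow> a y = 1" "\<And>y. \<lbrakk>\<bar>y\<bar> < r; y < h1\<rbrakk> \<Longrightarrow> a y = 0"
    and b: "\<And>y. \<lbrakk>\<bar>y\<bar> < r; h2 < y\<rbrakk> \<Longrightarrow> b y = 1" "\<And>y. \<lbrakk>\<bar>y\<bar> < r; y < h2\<rbrakk> \<Longrightarrow> b y = 0"
    and m: "a \<in> borel_measurable borel" "b \<in> borel_measurable borel"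
  shows "(LINT y|lborel. indicator {-r<..<r} y * (a y - b y)) = h2 - h1"
proof -
  have "(LINT y|lborel. indicator {-r<..<r} y * (a y - b y))
      = (LINT y|lborel. indicator {h1<..<r} y - indicator {h2<..<r} y)"
  proof (rule integral_cong_AE)
    show "AE y in lborel. indicator {-r<..<r} y * (a y - b y) = indicator {h1<..<r} y - indicator {h2<..<r} y"
    proof (rule AE_I')
      show "{h1, h2} \<in> null_sets lborel"
        by (intro finite_imp_null_set_lborel) auto
      have "indicator {-r<..<r} y * (a y - b y) = indicator {h1<..<r} y - indicator {h2<..<r} y"
        if "y \<notin> {h1, h2}" for y
        using that h a[of y] b[of y] by (cases "\<bar>y\<bar> < r"; cases "y < h1"; cases "y < h2") (auto simp: indicator_def)
      then show "{y \<in> space lborel. indicator {-r<..<r} y * (a y - b y) \<noteq> indicator {h1<..<r} y - indicator {h2<..<r} y} \<subseteq> {h1, h2}"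
        by blast
    qed
  qed (use m in simp_all)
  also have "\<dots> = h2 - h1"
    using h by (subst Bochner_Integration.integral_diff) (auto intro!: integrable_real_indicator)
  finally show ?thesis .
qed

subsection \<open>The jump of the winding number across a curve\<close>

text \<open>With \<open>g \<approx> \<tau>\<close> and \<open>q \<approx> 1\<close> this is, up to a factor \<open>\<epsilon>\<close>, a perturbation of the Poisson kernel
  \<open>\<epsilon> / (\<tau>\<^sup>2 + \<epsilon>\<^sup>2)\<close>.\<close>

lemma Re_near_kernel:
  fixes q g :: complex and \<tau> \<epsilon> :: real
  assumes q: "norm (q - 1) \<le> 1/10" and g: "norm (g - of_real \<tau>) \<le> \<bar>\<tau>\<bar> / 10" and \<epsilon>: "0 < \<epsilon>"
  shows "0 \<le> Re (q / (g\<^sup>2 + of_real (\<epsilon>\<^sup>2)))"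
    and "\<bar>\<tau>\<bar> \<le> \<epsilon> \<Longrightarrow> 1 / (10 * \<epsilon>\<^sup>2) \<le> Re (q / (g\<^sup>2 + of_real (\<epsilon>\<^sup>2)))"
proof -
  define A where "A = g\<^sup>2 + of_real (\<epsilon>\<^sup>2)"
  have q9: "9/10 \<le> Re q"
    using abs_Re_le_cmod[of "q - 1"] q by simp
  have ng: "norm g \<le> 11/10 * \<bar>\<tau>\<bar>"
    using norm_triangle_ineq[of "g - of_real \<tau>" "of_real \<tau>"] g by simp
  have "(norm g)\<^sup>2 \<le> (11/10 * \<bar>\<tau>\<bar>)\<^sup>2"
    using ng by (intro power_mono) auto
  also have "\<dots> = 121/100 * \<tau>\<^sup>2" by (simp add: power2_eq_square)
  finally have ng2: "(norm g)\<^sup>2 \<le> 121/100 * \<tau>\<^sup>2" .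
  \<comment> \<open>\<open>g\<^sup>2 - \<tau>\<^sup>2\<close> is factored as
    \<open>(g - \<tau>) * (g + \<tau>)\<close>; the constant 21/100 below is 1/10 times
    21/10.\<close>
  have "norm (g + of_real \<tau>) \<le> 21/10 * \<bar>\<tau>\<bar>"
    using norm_triangle_ineq[of g "of_real \<tau>"] ng by simp
  then have "norm (g - of_real \<tau>) * norm (g + of_real \<tau>) \<le> (\<bar>\<tau>\<bar> / 10) * (21/10 * \<bar>\<tau>\<bar>)"
    using g by (intro mult_mono) auto
  then have 1: "norm (g\<^sup>2 - of_real (\<tau>\<^sup>2)) \<le> 21/100 * \<tau>\<^sup>2"
    by (simp add: norm_mult[symmetric] power2_eq_square algebra_simps)
  have "norm (q - 1) * (norm g)\<^sup>2 \<le> 1/10 * (121/100 * \<tau>\<^sup>2)"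
    using q ng2 by (intro mult_mono) auto
  then have 2: "norm ((q - 1) * cnj (g\<^sup>2)) \<le> 121/1000 * \<tau>\<^sup>2"
    by (simp add: norm_mult norm_power)
  have "norm (cnj (g\<^sup>2) - of_real (\<tau>\<^sup>2)) = norm (g\<^sup>2 - of_real (\<tau>\<^sup>2))"
    by (metis complex_cnj_complex_of_real complex_cnj_diff complex_mod_cnj)
  with 1 have "norm (cnj (g\<^sup>2) - of_real (\<tau>\<^sup>2)) \<le> 21/100 * \<tau>\<^sup>2" by simp
  with 2 have "norm ((q - 1) * cnj (g\<^sup>2) + (cnj (g\<^sup>2) - of_real (\<tau>\<^sup>2))) \<le> 331/1000 * \<tau>\<^sup>2"
    using norm_triangle_ineq[of "(q - 1) * cnj (g\<^sup>2)" "cnj (g\<^sup>2) - of_real (\<tau>\<^sup>2)"] by linarith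
  also have "(q - 1) * cnj (g\<^sup>2) + (cnj (g\<^sup>2) - of_real (\<tau>\<^sup>2)) = q * cnj (g\<^sup>2) - of_real (\<tau>\<^sup>2)"
    by (simp add: algebra_simps)
  finally have "\<bar>Re (q * cnj (g\<^sup>2)) - \<tau>\<^sup>2\<bar> \<le> 331/1000 * \<tau>\<^sup>2"
    using abs_Re_le_cmod[of "q * cnj (g\<^sup>2) - of_real (\<tau>\<^sup>2)"] by simp
  then have 3: "0 \<le> Re (q * cnj (g\<^sup>2))"
    using zero_le_power2[of \<tau>] by linarith
  \<comment> \<open>\<open>Re (q / A)\<close> has the sign of \<open>Re (q * cnj A)\<close>. The
    first summand is \<open>\<tau>\<^sup>2\<close> up to a relative error of 331/1000 = 121/1000 +
    21/100, hence nonnegative; the second is at least 9/10 of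
    \<open>\<epsilon>\<^sup>2\<close>.\<close>
  have "Re (q * cnj A) = Re (q * cnj (g\<^sup>2)) + \<epsilon>\<^sup>2 * Re q"
    by (simp add: A_def algebra_simps)
  moreover have "\<epsilon>\<^sup>2 * (9/10) \<le> \<epsilon>\<^sup>2 * Re q"
    using q9 by (intro mult_left_mono) auto
  ultimately have 4: "9/10 * \<epsilon>\<^sup>2 \<le> Re (q * cnj A)"
    using 3 by linarith
  have \<epsilon>2: "0 < \<epsilon>\<^sup>2" using \<epsilon> by simp
  have 5: "0 \<le> Re (q * cnj A)" using 4 \<epsilon>2 by linarith
  have A0: "A \<noteq> 0"
  proof
    assume "A = 0" then show False using 4 \<epsilon>2 by simp
  qed
  have eq: "Re (q / A) = Re (q * cnj A) / (norm A)\<^sup>2"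
    by (simp add: complex_div_cnj[of q A] Re_divide_of_real flip: of_real_power)
  show "0 \<le> Re (q / (g\<^sup>2 + of_real (\<epsilon>\<^sup>2)))"
    unfolding A_def[symmetric] eq by (rule divide_nonneg_nonneg[OF 5 zero_le_power2])
  assume \<tau>: "\<bar>\<tau>\<bar> \<le> \<epsilon>"
  have "norm A \<le> (norm g)\<^sup>2 + \<epsilon>\<^sup>2"
    unfolding A_def by (rule order_trans[OF norm_triangle_ineq]) (simp add: norm_power)
  also have "\<dots> \<le> 221/100 * \<epsilon>\<^sup>2"
    using ng2 power_mono[OF \<tau>, of 2] by simp
  finally have "(norm A)\<^sup>2 \<le> (221/100 * \<epsilon>\<^sup>2)\<^sup>2"
    by (intro power_mono) auto
  \<comment> \<open>The square of 221/100 is below 9, a value chosen so that the quotient of 9/10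
    and 9 is 1/10.\<close>
  also have "\<dots> \<le> 9 * \<epsilon>\<^sup>2 * \<epsilon>\<^sup>2"
    using \<epsilon> by (simp add: power2_eq_square)
  finally have "9/10 * \<epsilon>\<^sup>2 / (9 * \<epsilon>\<^sup>2 * \<epsilon>\<^sup>2) \<le> Re (q * cnj A) / (norm A)\<^sup>2"
    using A0 by (intro frac_le[OF 5 4]) auto
  also have "9/10 * \<epsilon>\<^sup>2 / (9 * \<epsilon>\<^sup>2 * \<epsilon>\<^sup>2) = 1 / (10 * \<epsilon>\<^sup>2)"
    using \<epsilon> by (simp add: field_simps)
  finally show "1 / (10 * \<epsilon>\<^sup>2) \<le> Re (q / (g\<^sup>2 + of_real (\<epsilon>\<^sup>2)))"
    unfolding A_def[symmetric] eq .
qed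

text \<open>This is the Cauchy integral in the parameter of the unit interval; the chain rule
  contributes the factor \<open>L\<close>. The constant stands inside the integral so that real
  parts can be compared pointwise.\<close>

lemma winding_number_closed_C1:
  fixes G D :: "real \<Rightarrow> complex"
  assumes G: "\<And>t. (G has_vector_derivative D t) (at t)" and D: "continuous_on UNIV D"
    and z: "z \<notin> path_image (\<lambda>x. G (L * x))"
  shows "winding_number (\<lambda>x. G (L * x)) z
    = integral {0..1} (\<lambda>x. of_real L / (2 * of_real pi * \<i>) * (D (L * x) / (G (L * x) - z)))"
    and "(\<lambda>x. of_real L / (2 * of_real pi * \<i>) * (D (L * x) / (G (L * x) - z))) integrable_on {0..1}"
proof -
  have "((\<lambda>x. L * x) has_vector_derivative L) (at x)" for x
    by (auto simp flip: has_real_derivative_iff_has_vector_derivative intro!: derivative_eq_intros)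
  then have d: "((\<lambda>x. G (L * x)) has_vector_derivative L *\<^sub>R D (L * x)) (at x)" for x
    using vector_diff_chain_at[of "\<lambda>x. L * x" L x G "D (L * x)"] G
    by (simp add: o_def)
  have cG: "continuous_on UNIV G"
    using G by (meson continuous_at_imp_continuous_on has_vector_derivative_continuous)
  have "(\<lambda>x. G (L * x)) C1_differentiable_on {0..1}"
    unfolding C1_differentiable_on_def
    by (rule exI[of _ "\<lambda>x. L *\<^sub>R D (L * x)"])
      (auto intro!: d continuous_intros continuous_on_compose2[OF D])
  then have vp: "valid_path (\<lambda>x. G (L * x))"
    by (simp add: valid_path_def C1_differentiable_imp_piecewise)
  have "winding_number (\<lambda>x. G (L * x)) z
      = 1 / (2 * of_real pi * \<i>) * integral {0..1} (\<lambda>x. 1 / (G (L * x) - z) * vector_derivative (\<lambda>x. G (L * x)) (at x))"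
    using winding_number_valid_path[OF vp z] by (simp add: contour_integral_integral)
  also have "\<dots> = integral {0..1} (\<lambda>x. 1 / (2 * of_real pi * \<i>) * (1 / (G (L * x) - z) * vector_derivative (\<lambda>x. G (L * x)) (at x)))"
    by (rule integral_mult_right[symmetric])
  also have "\<dots> = integral {0..1} (\<lambda>x. of_real L / (2 * of_real pi * \<i>) * (D (L * x) / (G (L * x) - z)))"
    by (rule integral_cong) (simp add: vector_derivative_at[OF d] scaleR_conv_of_real)
  finally show "winding_number (\<lambda>x. G (L * x)) z
    = integral {0..1} (\<lambda>x. of_real L / (2 * of_real pi * \<i>) * (D (L * x) / (G (L * x) - z)))" .
  show "(\<lambda>x. of_real L / (2 * of_real pi * \<i>) * (D (L * x) / (G (L * x) - z))) integrable_on {0..1}"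
    using z by (intro integrable_continuous_interval)
      (auto simp: path_image_def intro!: continuous_intros continuous_on_compose2[OF D] continuous_on_compose2[OF cG])
qed

text \<open>After division by \<open>v = D s\<close>, the difference of the Cauchy kernels at \<open>G s \<plusminus> \<i> \<epsilon> v\<close> is
  \<open>2 \<i> \<epsilon> q / (g\<^sup>2 + \<epsilon>\<^sup>2)\<close> with \<open>g = (G - G s) / v\<close> and \<open>q = D / v\<close>. Its contribution is bounded below
  by a positive constant near \<open>s\<close> and is \<open>O(\<epsilon>)\<close> elsewhere.\<close>

lemma winding_number_jump:
  fixes G D :: "real \<Rightarrow> complex" and L s :: real
  assumes L: "0 < L" and s: "s \<in> {0..<L}"
    and G: "\<And>t. (G has_vector_derivative D t) (at t)" and D: "continuous_on UNIV D"
    and per: "\<And>t. G (t + L) = G t" "\<And>t. D (t + L) = D t"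
    and inj: "\<And>t. \<lbrakk>t \<in> {0..L}; G t = G s\<rbrakk> \<Longrightarrow> t = s \<or> t = s + L"
    and v: "norm (D s) = 1"
  shows "\<forall>\<^sub>F \<epsilon> in at_right 0.
    G s + \<i> * of_real \<epsilon> * D s \<notin> path_image (\<lambda>x. G (L * x)) \<longrightarrow>
    G s - \<i> * of_real \<epsilon> * D s \<notin> path_image (\<lambda>x. G (L * x)) \<longrightarrow>
    Re (winding_number (\<lambda>x. G (L * x)) (G s - \<i> * of_real \<epsilon> * D s))
      < Re (winding_number (\<lambda>x. G (L * x)) (G s + \<i> * of_real \<epsilon> * D s))"
proof -
  define v where "v = D s"
  define g where "g t = (G t - G s) / v" for t
  define q where "q t = D t / v" for t
  \<comment> \<open>The factor \<open>\<epsilon> / pi\<close> is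
    \<open>2 * \<i> * \<epsilon>\<close> from the difference of the kernels divided by
    \<open>2 * pi * \<i>\<close> from the Cauchy integral.\<close>
  define k where "k \<epsilon> t = \<epsilon> / pi * Re (q t / ((g t)\<^sup>2 + of_real (\<epsilon>\<^sup>2)))" for \<epsilon> t
  have v1: "norm v = 1" and v0: "v \<noteq> 0" using v by (auto simp: v_def)
  have cG: "continuous_on A G" for A
    using G by (meson continuous_at_imp_continuous_on has_vector_derivative_continuous)
  \<comment> \<open>The tolerances 1/10, here and for \<open>\<delta>2\<close>, are those of
    \<open>Re_near_kernel\<close>.\<close>
  obtain \<delta>1 where \<delta>1: "0 < \<delta>1" "\<And>t. \<bar>t - s\<bar> < \<delta>1 \<Longrightarrow> norm (D t - v) \<le> 1/10"
  proof -
    have "isCont D s" using D by (simp add: continuous_on_eq_continuous_at)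
    then obtain d where "0 < d" "\<forall>t. dist t s < d \<longrightarrow> dist (D t) (D s) < 1/10"
      unfolding continuous_at_eps_delta by (metis zero_less_divide_1_iff zero_less_numeral)
    then show ?thesis by (intro that[of d]) (auto simp: dist_norm v_def less_imp_le)
  qed
  obtain \<delta>2 where \<delta>2: "0 < \<delta>2" "\<And>t. \<bar>t - s\<bar> < \<delta>2 \<Longrightarrow> norm (G t - G s - (t - s) *\<^sub>R v) \<le> \<bar>t - s\<bar> / 10"
  proof -
    have "(G has_derivative (\<lambda>h. h *\<^sub>R v)) (at s)"
      using G[of s] by (simp add: has_vector_derivative_def v_def)
    then have "\<exists>d>0. \<forall>t. norm (t - s) < d \<longrightarrow> norm (G t - G s - (t - s) *\<^sub>R v) \<le> 1/10 * norm (t - s)"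
      unfolding has_derivative_at_alt by (metis zero_less_divide_1_iff zero_less_numeral)
    then show ?thesis using that by auto
  qed
  define \<delta> where "\<delta> = min \<delta>1 \<delta>2"
  have \<delta>: "0 < \<delta>" using \<delta>1 \<delta>2 by (simp add: \<delta>_def)
  have q1: "norm (q t - 1) \<le> 1/10" if "\<bar>t - s\<bar> < \<delta>" for t
  proof -
    have "q t - 1 = (D t - v) / v" using v0 by (simp add: q_def field_simps)
    then have "norm (q t - 1) = norm (D t - v)" by (simp add: norm_divide v1)
    then show ?thesis using \<delta>1(2)[of t] that by (simp add: \<delta>_def)
  qed
  have g1: "norm (g t - of_real (t - s)) \<le> \<bar>t - s\<bar> / 10" if "\<bar>t - s\<bar> < \<delta>" for t
  proof -
    have "g t - of_real (t - s) = (G t - G s - (t - s) *\<^sub>R v) / v"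
      using v0 by (simp add: g_def scaleR_conv_of_real field_simps)
    then have "norm (g t - of_real (t - s)) = norm (G t - G s - (t - s) *\<^sub>R v)"
      by (simp add: norm_divide v1)
    then show ?thesis using \<delta>2(2)[of t] that by (simp add: \<delta>_def)
  qed
  have near: "0 \<le> k \<epsilon> t" if "\<bar>t - s\<bar> < \<delta>" "0 < \<epsilon>" for t \<epsilon>
    unfolding k_def using Re_near_kernel(1)[OF q1 g1 that(2)] that by (intro mult_nonneg_nonneg) auto
  have vnear: "1 / (10 * pi * \<epsilon>) \<le> k \<epsilon> t" if "\<bar>t - s\<bar> < \<delta>" "0 < \<epsilon>" "\<bar>t - s\<bar> \<le> \<epsilon>" for t \<epsilon>
  proof -
    have "\<epsilon> / pi * (1 / (10 * \<epsilon>\<^sup>2)) \<le> k \<epsilon> t"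
      unfolding k_def using Re_near_kernel(2)[OF q1 g1 that(2)] that by (intro mult_left_mono) auto
    then show ?thesis using that by (simp add: power2_eq_square field_simps)
  qed
  have kper: "k \<epsilon> (t - L) = k \<epsilon> t" for \<epsilon> t
    using per(1)[of "t - L"] per(2)[of "t - L"] by (simp add: k_def g_def q_def)
  \<comment> \<open>Two balls are removed because the curve is back at \<open>G s\<close> at the
    parameter \<open>s + L\<close>, which for small \<open>s\<close> is close to parameters below
    \<open>L\<close>. On the compact rest, \<open>inj\<close> keeps \<open>g\<close> away from
    0.\<close>
  define C where "C = {0..L} - ball s \<delta> - ball (s + L) \<delta>"
  have "compact C" unfolding C_def by (intro compact_diff) auto
  have "\<exists>c>0. \<forall>t\<in>C. c \<le> norm (g t)"
  proof (cases "C = {}")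
    case False
    have "continuous_on C (\<lambda>t. norm (g t))"
      unfolding g_def using v0 by (intro continuous_intros cG) auto
    from continuous_attains_inf[OF \<open>compact C\<close> False this]
    obtain u where u: "u \<in> C" "\<And>t. t \<in> C \<Longrightarrow> norm (g u) \<le> norm (g t)" by auto
    have "G u \<noteq> G s"
      using inj[of u] u(1) \<delta> by (auto simp: C_def)
    then have "0 < norm (g u)" using v0 by (simp add: g_def)
    with u(2) show ?thesis by blast
  qed (auto intro: exI[of _ 1])
  then obtain c where c: "0 < c" "\<And>t. t \<in> C \<Longrightarrow> c \<le> norm (g t)" by auto
  have "bounded (D ` {0..L})"
    by (intro compact_imp_bounded compact_continuous_image continuous_on_subset[OF D]) auto
  then obtain M where M: "\<And>t. t \<in> {0..L} \<Longrightarrow> norm (D t) \<le> M" "0 < M"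
    unfolding bounded_pos by (metis imageI)
  define B where "B = 2 * M / (pi * c\<^sup>2)"
  have B: "0 < B" using M c by (simp add: B_def)
  \<comment> \<open>For \<open>\<epsilon> \<le> c / 2\<close> the denominator has norm at least
    \<open>c\<^sup>2 - \<epsilon>\<^sup>2\<close>, hence at least \<open>c\<^sup>2 / 2\<close>; this
    gives the constant \<open>B\<close>.\<close>
  have far: "- (\<epsilon> * B) \<le> k \<epsilon> t" if t: "t \<in> C" and \<epsilon>: "0 < \<epsilon>" "\<epsilon> \<le> c / 2" for t \<epsilon>
  proof -
    have tL: "t \<in> {0..L}" using t by (simp add: C_def)
    have "\<epsilon>\<^sup>2 \<le> c\<^sup>2 / 4"
      using power_mono[of \<epsilon> "c / 2" 2] \<epsilon> by (simp add: power_divide)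
    moreover have "c\<^sup>2 \<le> (norm (g t))\<^sup>2" using c t by (intro power_mono) auto
    moreover have "(norm (g t))\<^sup>2 - \<epsilon>\<^sup>2 \<le> norm ((g t)\<^sup>2 + of_real (\<epsilon>\<^sup>2))"
      using norm_diff_ineq[of "(g t)\<^sup>2" "of_real (\<epsilon>\<^sup>2)"] by (simp add: norm_power)
    ultimately have den: "c\<^sup>2 / 2 \<le> norm ((g t)\<^sup>2 + of_real (\<epsilon>\<^sup>2))"
      using zero_le_power2[of c] by linarith
    have "norm (q t) \<le> M" using M(1)[OF tL] by (simp add: q_def norm_divide v1)
    then have "norm (q t / ((g t)\<^sup>2 + of_real (\<epsilon>\<^sup>2))) \<le> M / (c\<^sup>2 / 2)"
      unfolding norm_divide using den c M by (intro frac_le) auto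
    then have "- (M / (c\<^sup>2 / 2)) \<le> Re (q t / ((g t)\<^sup>2 + of_real (\<epsilon>\<^sup>2)))"
      using abs_Re_le_cmod[of "q t / ((g t)\<^sup>2 + of_real (\<epsilon>\<^sup>2))"] by linarith
    then have "\<epsilon> / pi * - (M / (c\<^sup>2 / 2)) \<le> k \<epsilon> t"
      unfolding k_def using \<epsilon> by (intro mult_left_mono) auto
    then show ?thesis by (simp add: B_def mult.commute[of M])
  qed
  have low: "- (\<epsilon> * B) \<le> k \<epsilon> t" if t: "t \<in> {0..L}" and \<epsilon>: "0 < \<epsilon>" "\<epsilon> \<le> c / 2" for t \<epsilon>
  proof -
    have "0 \<le> \<epsilon> * B" using \<epsilon> B by simp
    moreover have "\<bar>t - s\<bar> < \<delta> \<or> \<bar>(t - L) - s\<bar> < \<delta> \<or> t \<in> C"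
      using t by (auto simp: C_def dist_real_def)
    ultimately show ?thesis
      using near[of t \<epsilon>] near[of "t - L" \<epsilon>] far[OF _ \<epsilon>, of t] \<epsilon> kper[of \<epsilon> t] by linarith
  qed
  \<comment> \<open>\<open>\<delta>\<close> and \<open>L - s\<close> keep the window from
    \<open>s\<close> to \<open>s + \<epsilon>\<close> near \<open>s\<close> and inside the parameter
    interval, \<open>c / 2\<close> serves \<open>far\<close>, and the last entry makes the possible
    loss \<open>L * (\<epsilon> * B)\<close> smaller than the gain
    \<open>1 / (10 * pi)\<close>.\<close>
  define \<epsilon>0 where "\<epsilon>0 = Min {\<delta>, L - s, c / 2, 1 / (10 * pi * L * B)}"
  have "0 < \<epsilon>0" using \<delta> s c B L by (auto simp: \<epsilon>0_def)
  have "Re (winding_number (\<lambda>x. G (L * x)) (G s - \<i> * of_real \<epsilon> * D s))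
      < Re (winding_number (\<lambda>x. G (L * x)) (G s + \<i> * of_real \<epsilon> * D s))"
    if \<epsilon>: "0 < \<epsilon>" "\<epsilon> < \<epsilon>0"
      and z: "G s + \<i> * of_real \<epsilon> * D s \<notin> path_image (\<lambda>x. G (L * x))"
        "G s - \<i> * of_real \<epsilon> * D s \<notin> path_image (\<lambda>x. G (L * x))" for \<epsilon>
  proof -
    have \<epsilon>': "\<epsilon> < \<delta>" "s + \<epsilon> < L" "\<epsilon> \<le> c / 2" "\<epsilon> < 1 / (10 * pi * L * B)"
      using \<epsilon> by (auto simp: \<epsilon>0_def)
    define W where "W = winding_number (\<lambda>x. G (L * x))"
    define zp zm where "zp = G s + \<i> * of_real \<epsilon> * v" and "zm = G s - \<i> * of_real \<epsilon> * v"
    define F where "F z x = of_real L / (2 * of_real pi * \<i>) * (D (L * x) / (G (L * x) - z))" for z x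
    have zpm: "zp \<notin> path_image (\<lambda>x. G (L * x))" "zm \<notin> path_image (\<lambda>x. G (L * x))"
      using z by (auto simp: zp_def zm_def v_def)
    have hp: "(F zp has_integral W zp) {0..1}" and hm: "(F zm has_integral W zm) {0..1}"
      unfolding F_def W_def using winding_number_closed_C1[OF G D] zpm
      by (simp_all add: integrable_integral)
    have h: "((\<lambda>x. Re (F zp x - F zm x)) has_integral Re (W zp - W zm)) {0..1}"
      using has_integral_Re[OF has_integral_diff[OF hp hm]] .
    have Fk: "Re (F zp x - F zm x) = L * k \<epsilon> (L * x)" if x: "x \<in> {0..1}" for x
    proof -
      define y where "y = L * x"
      have Re_mult: "Re (of_real a * z) = a * Re z" for a z by simp
      have ne: "G y - zp \<noteq> 0" "G y - zm \<noteq> 0"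
        using zpm x by (auto simp: path_image_def y_def)
      have gv: "G y - G s = g y * v" "D y = q y * v" using v0 by (auto simp: g_def q_def)
      \<comment> \<open>The factors are \<open>(g y - \<i> * \<epsilon>) * v\<close> and
        \<open>(g y + \<i> * \<epsilon>) * v\<close>.\<close>
      have prod: "(G y - zp) * (G y - zm) = v\<^sup>2 * ((g y)\<^sup>2 + of_real (\<epsilon>\<^sup>2))"
      proof -
        have "G y - zp = g y * v - \<i> * of_real \<epsilon> * v" "G y - zm = g y * v + \<i> * of_real \<epsilon> * v"
          by (simp_all add: zp_def zm_def flip: gv(1))
        then have "(G y - zp) * (G y - zm) = (g y * v - \<i> * of_real \<epsilon> * v) * (g y * v + \<i> * of_real \<epsilon> * v)"
          by (simp only:)
        also have "\<dots> = v\<^sup>2 * ((g y)\<^sup>2 - (\<i> * \<i>) * of_real \<epsilon> * of_real \<epsilon>)"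
          by (simp only: power2_eq_square ring_distribs mult_ac) (simp add: algebra_simps)
        finally show ?thesis by (simp add: power2_eq_square)
      qed
      have den: "(g y)\<^sup>2 + of_real (\<epsilon>\<^sup>2) \<noteq> 0" using prod ne by auto
      have "D y / (G y - zp) - D y / (G y - zm) = D y * (zp - zm) / ((G y - zp) * (G y - zm))"
        using ne by (simp add: field_simps)
      also have "\<dots> = q y * v * (2 * \<i> * of_real \<epsilon> * v) / (v\<^sup>2 * ((g y)\<^sup>2 + of_real (\<epsilon>\<^sup>2)))"
        by (simp add: prod gv(2)) (simp add: zp_def zm_def)
      also have "\<dots> = 2 * \<i> * of_real \<epsilon> * (q y / ((g y)\<^sup>2 + of_real (\<epsilon>\<^sup>2)))"
        using v0 den by (simp add: power2_eq_square)
      finally have *: "D y / (G y - zp) - D y / (G y - zm) = 2 * \<i> * of_real \<epsilon> * (q y / ((g y)\<^sup>2 + of_real (\<epsilon>\<^sup>2)))" .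
      have "F zp x - F zm x = of_real L / (2 * of_real pi * \<i>) * (D y / (G y - zp) - D y / (G y - zm))"
        by (simp add: F_def y_def right_diff_distrib)
      also have "\<dots> = of_real (L * (\<epsilon> / pi)) * (q y / ((g y)\<^sup>2 + of_real (\<epsilon>\<^sup>2)))"
        unfolding * by simp
      finally have "Re (F zp x - F zm x) = L * (\<epsilon> / pi) * Re (q y / ((g y)\<^sup>2 + of_real (\<epsilon>\<^sup>2)))"
        by (simp only: Re_mult)
      then show ?thesis by (simp add: k_def y_def)
    qed
    \<comment> \<open>This is the window from \<open>s\<close> to \<open>s + \<epsilon>\<close> in
      the rescaled parameter. Its length \<open>\<epsilon> / L\<close> times the lower bound
      \<open>L / (10 * pi * \<epsilon>)\<close> is a gain independent of
      \<open>\<epsilon>\<close>.\<close>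
    define a b where "a = s / L" and "b = (s + \<epsilon>) / L"
    have ab: "0 \<le> a" "a \<le> b" "b \<le> 1" "b - a = \<epsilon> / L"
      using s L \<epsilon> \<epsilon>' by (auto simp: a_def b_def field_simps)
    have "((\<lambda>x. if x \<in> {a..b} then L / (10 * pi * \<epsilon>) else 0) has_integral (L / (10 * pi * \<epsilon>)) * (b - a)) {0..1}"
      using has_integral_const_real[of "L / (10 * pi * \<epsilon>)" a b] ab
      by (subst has_integral_restrict) (auto simp: mult.commute)
    from has_integral_diff[OF this has_integral_const_real[of "L * (\<epsilon> * B)" 0 1]]
    have lower: "((\<lambda>x. (if x \<in> {a..b} then L / (10 * pi * \<epsilon>) else 0) - L * (\<epsilon> * B)) has_integral
        1 / (10 * pi) - L * (\<epsilon> * B)) {0..1}"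
      using L \<epsilon> by (simp add: ab(4))
    have "1 / (10 * pi) - L * (\<epsilon> * B) \<le> Re (W zp - W zm)"
    proof (rule has_integral_le[OF lower h])
      fix x :: real assume x: "x \<in> {0..1}"
      have Lx: "L * x \<in> {0..L}" using x L by (auto simp: mult_le_cancel_left1)
      have "(if x \<in> {a..b} then 1 / (10 * pi * \<epsilon>) else 0) - \<epsilon> * B \<le> k \<epsilon> (L * x)"
      proof (cases "x \<in> {a..b}")
        case True
        then have "s \<le> L * x" "L * x \<le> s + \<epsilon>" using L by (auto simp: a_def b_def field_simps)
        then have "1 / (10 * pi * \<epsilon>) \<le> k \<epsilon> (L * x)"
          using \<epsilon> \<epsilon>' by (intro vnear) auto
        moreover have "0 \<le> \<epsilon> * B" using \<epsilon> B by simp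
        ultimately show ?thesis using True by simp
      qed (use low[OF Lx \<epsilon>(1) \<epsilon>'(3)] in auto)
      then have "L * ((if x \<in> {a..b} then 1 / (10 * pi * \<epsilon>) else 0) - \<epsilon> * B) \<le> L * k \<epsilon> (L * x)"
        using L by (intro mult_left_mono) auto
      then show "(if x \<in> {a..b} then L / (10 * pi * \<epsilon>) else 0) - L * (\<epsilon> * B) \<le> Re (F zp x - F zm x)"
        unfolding Fk[OF x] by (cases "x \<in> {a..b}") (auto simp: right_diff_distrib)
    qed
    moreover have "L * (\<epsilon> * B) < 1 / (10 * pi)"
      using \<epsilon>'(4) L B by (simp add: field_simps)
    ultimately show ?thesis by (simp add: W_def zp_def zm_def v_def)
  qed
  then show ?thesis
    using \<open>0 < \<epsilon>0\<close> by (auto simp: eventually_at_right_field)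
qed

subsection \<open>The boundary inside the disk\<close>

text \<open>By \<open>transversal\<close>, the distance from \<open>G s\<close> has no critical
  value in (0, r] inside the period. It therefore rises past \<open>r\<close> once and comes back
  once: a third crossing would force a minimum at a value not above \<open>r\<close>. By
  \<open>graph\<close>, \<open>x\<close> does not vanish on the two arcs inside the disk, so it
  keeps the sign it has just after \<open>s\<close> and just before \<open>s + L\<close>.\<close>

lemma two_sphere_crossings:
  fixes G D :: "real \<Rightarrow> complex" and L r s :: real
  assumes L: "0 < L" and r: "0 < r"
    and G: "\<And>t. (G has_vector_derivative D t) (at t)"
    and per: "G (s + L) = G s" "D (s + L) = D s"
    and inj: "\<And>t. t \<in> {s<..<s + L} \<Longrightarrow> G t \<noteq> G s"
    and transversal: "\<And>t. \<lbrakk>t \<in> {s<..<s + L}; dist (G s) (G t) \<le> r\<rbrakk> \<Longrightarrow> inner (D t) (G t - G s) \<noteq> 0"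
    and graph: "\<And>t. \<lbrakk>t \<in> {s<..<s + L}; dist (G s) (G t) \<le> r\<rbrakk> \<Longrightarrow> inner (D s) (G t - G s) \<noteq> 0"
    and v: "D s \<noteq> 0"
  obtains t1 t2 where "t1 \<in> {s<..<s + L}" "t2 \<in> {s<..<s + L}"
    "{t \<in> {s..s + L}. dist (G s) (G t) = r} = {t1, t2}"
    "0 < inner (D s) (G t1 - G s)" "inner (D s) (G t2 - G s) < 0"
proof -
  \<comment> \<open>The squared distance is differentiable also where the distance vanishes.\<close>
  define \<rho> where "\<rho> t = (dist (G s) (G t))\<^sup>2" for t
  define x where "x t = inner (D s) (G t - G s)" for t
  have \<rho>_inner: "\<rho> t = inner (G t - G s) (G t - G s)" for t
    by (simp add: \<rho>_def dist_norm norm_minus_commute[of "G s"] power2_norm_eq_inner)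
  have d\<rho>: "(\<rho> has_real_derivative 2 * inner (D t) (G t - G s)) (at t)" for t
  proof -
    have "((\<lambda>t. G t - G s) has_vector_derivative D t) (at t)"
      using G by (auto intro!: derivative_eq_intros)
    then have "((\<lambda>t. inner (G t - G s) (G t - G s)) has_derivative
        (\<lambda>h. inner (G t - G s) (h *\<^sub>R D t) + inner (h *\<^sub>R D t) (G t - G s))) (at t)"
      unfolding has_vector_derivative_def by (intro has_derivative_inner)
    then show ?thesis
      unfolding has_field_derivative_def \<rho>_inner[abs_def]
      by (rule has_derivative_eq_rhs) (auto simp: inner_commute algebra_simps)
  qed
  have dx: "(x has_real_derivative inner (D s) (D t)) (at t)" for t
  proof -
    have "((\<lambda>t. G t - G s) has_vector_derivative D t) (at t)"
      using G by (auto intro!: derivative_eq_intros)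
    then have "((\<lambda>t. inner (D s) (G t - G s)) has_derivative (\<lambda>h. inner (D s) (h *\<^sub>R D t))) (at t)"
      unfolding has_vector_derivative_def by (rule has_derivative_inner_right)
    then show ?thesis
      unfolding has_field_derivative_def x_def[abs_def]
      by (rule has_derivative_eq_rhs) (auto simp: algebra_simps)
  qed
  have c\<rho>: "continuous_on A \<rho>" for A
    using d\<rho> by (meson DERIV_continuous continuous_at_imp_continuous_on)
  have cx: "continuous_on A x" for A
    using dx by (meson DERIV_continuous continuous_at_imp_continuous_on)
  have le_iff: "dist (G s) (G t) \<le> r \<longleftrightarrow> \<rho> t \<le> r\<^sup>2" for t
    unfolding \<rho>_def using r abs_le_square_iff[of "dist (G s) (G t)" r] by simp
  have eq_iff: "dist (G s) (G t) = r \<longleftrightarrow> \<rho> t = r\<^sup>2" for t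
    unfolding \<rho>_def using r by (simp add: power2_eq_iff_nonneg)
  have crit: "r\<^sup>2 < \<rho> t" if "t \<in> {s<..<s + L}" "(\<rho> has_real_derivative 0) (at t)" for t
  proof (rule ccontr)
    assume "\<not> r\<^sup>2 < \<rho> t"
    with transversal[OF that(1)] have "inner (D t) (G t - G s) \<noteq> 0" by (simp add: le_iff)
    moreover have "2 * inner (D t) (G t - G s) = 0"
      using DERIV_unique[OF d\<rho> that(2)] .
    ultimately show False by simp
  qed
  have \<rho>0: "\<rho> s = 0" "\<rho> (s + L) = 0" by (simp_all add: \<rho>_def per)
  have r2: "0 < r\<^sup>2" using r by simp
  obtain t0 where t0: "s < t0" "t0 < s + L" "(\<rho> has_real_derivative 0) (at t0)"
    using Rolle[of s "s + L" \<rho>] L \<rho>0 c\<rho> d\<rho> by (auto simp: real_differentiable_def)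
  then have \<rho>t0: "r\<^sup>2 < \<rho> t0" using crit by simp
  obtain t1 where t1: "s \<le> t1" "t1 \<le> t0" "\<rho> t1 = r\<^sup>2"
    using IVT'[of \<rho> s "r\<^sup>2" t0] \<rho>0 r2 \<rho>t0 t0 c\<rho> by auto
  obtain t2 where t2: "t0 \<le> t2" "t2 \<le> s + L" "\<rho> t2 = r\<^sup>2"
    using IVT2'[of \<rho> "s + L" "r\<^sup>2" t0] \<rho>0 r2 \<rho>t0 t0 c\<rho> by auto
  have t1': "s < t1" "t1 < t0" and t2': "t0 < t2" "t2 < s + L"
    using t1 t2 \<rho>0 r2 \<rho>t0 by (auto simp: less_le)
  \<comment> \<open>A dip below the level between two crossings would contain an interior minimum, a
    critical point excluded by \<open>crit\<close>.\<close>
  have above: "r\<^sup>2 \<le> \<rho> t"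
    if ab: "s < a" "b < s + L" "\<rho> a = r\<^sup>2" "\<rho> b = r\<^sup>2" and t: "t \<in> {a..b}" for a b t
  proof (rule ccontr)
    assume "\<not> r\<^sup>2 \<le> \<rho> t"
    obtain m where m: "m \<in> {a..b}" "\<And>u. u \<in> {a..b} \<Longrightarrow> \<rho> m \<le> \<rho> u"
      using continuous_attains_inf[of "{a..b}" \<rho>] c\<rho> t by auto
    have lt: "\<rho> m < r\<^sup>2" using m(2)[OF t] \<open>\<not> r\<^sup>2 \<le> \<rho> t\<close> by simp
    then have m': "a < m" "m < b" using m(1) ab by (auto simp: less_le)
    have "2 * inner (D m) (G m - G s) = 0"
    proof (rule DERIV_local_min[OF d\<rho>])
      show "0 < min (m - a) (b - m)" using m' by simp
      show "\<forall>y. \<bar>m - y\<bar> < min (m - a) (b - m) \<longrightarrow> \<rho> m \<le> \<rho> y"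
        by (auto intro!: m(2))
    qed
    then have "r\<^sup>2 < \<rho> m" using d\<rho>[of m] ab m' by (intro crit) auto
    with lt show False by simp
  qed
  \<comment> \<open>By \<open>above\<close>, the middle crossing is a local minimum at exactly the
    level \<open>r\<^sup>2\<close>; the strict inequality in \<open>crit\<close> excludes this
    too.\<close>
  have no_three: False
    if abc: "s < a" "a < b" "b < c" "c < s + L" "\<rho> a = r\<^sup>2" "\<rho> b = r\<^sup>2" "\<rho> c = r\<^sup>2" for a b c
  proof -
    have "2 * inner (D b) (G b - G s) = 0"
    proof (rule DERIV_local_min[OF d\<rho>])
      show "0 < min (b - a) (c - b)" using abc by simp
      show "\<forall>y. \<bar>b - y\<bar> < min (b - a) (c - b) \<longrightarrow> \<rho> b \<le> \<rho> y"
      proof (intro allI impI)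
        fix y assume "\<bar>b - y\<bar> < min (b - a) (c - b)"
        then have "y \<in> {a..c}" by auto
        then show "\<rho> b \<le> \<rho> y" using above[of a c y] abc by simp
      qed
    qed
    then have "r\<^sup>2 < \<rho> b" using d\<rho>[of b] abc by (intro crit) auto
    then show False using abc by simp
  qed
  have only: "t = t1 \<or> t = t2" if "t \<in> {s<..<s + L}" "\<rho> t = r\<^sup>2" for t
    using no_three[of t t1 t2] no_three[of t1 t t2] no_three[of t1 t2 t] that t1 t1' t2 t2'
    by (metis greaterThanLessThan_iff less_trans linorder_neqE_linordered_idom)
  have set: "{t \<in> {s..s + L}. dist (G s) (G t) = r} = {t1, t2}"
  proof (intro equalityI subsetI)
    fix t assume "t \<in> {t \<in> {s..s + L}. dist (G s) (G t) = r}"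
    then have t: "s \<le> t" "t \<le> s + L" "\<rho> t = r\<^sup>2" by (auto simp: eq_iff)
    moreover have "t \<noteq> s" "t \<noteq> s + L" using t \<rho>0 r2 by auto
    ultimately show "t \<in> {t1, t2}" using only[of t] by auto
  qed (use t1 t1' t2 t2' t0 in \<open>auto simp: eq_iff\<close>)
  \<comment> \<open>Exceeding the level before \<open>t1\<close> would produce a crossing between
    \<open>s\<close> and \<open>t\<close>, contrary to \<open>only\<close>.\<close>
  have in1: "\<rho> t \<le> r\<^sup>2" if t: "s < t" "t \<le> t1" for t
  proof (rule ccontr)
    assume *: "\<not> \<rho> t \<le> r\<^sup>2"
    obtain u where u: "s \<le> u" "u \<le> t" "\<rho> u = r\<^sup>2"
      using IVT'[of \<rho> s "r\<^sup>2" t] \<rho>0 r2 * t c\<rho> by auto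
    then have "s < u" "u < t" using \<rho>0 r2 * by (auto simp: less_le)
    then show False using only[of u] u t t1' t2' by auto
  qed
  have in2: "\<rho> t \<le> r\<^sup>2" if t: "t2 \<le> t" "t < s + L" for t
  proof (rule ccontr)
    assume *: "\<not> \<rho> t \<le> r\<^sup>2"
    obtain u where u: "t \<le> u" "u \<le> s + L" "\<rho> u = r\<^sup>2"
      using IVT2'[of \<rho> "s + L" "r\<^sup>2" t] \<rho>0 r2 * t c\<rho> by auto
    then have "u < s + L" "t < u" using \<rho>0 r2 * by (auto simp: less_le)
    then show False using only[of u] u t t1' t2' by auto
  qed
  have x0: "x s = 0" "x (s + L) = 0" by (simp_all add: x_def per)
  have vv: "0 < inner (D s) (D s)" using v by simp
  have "0 < x t1"
  proof (rule ccontr)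
    assume neg: "\<not> 0 < x t1"
    obtain d where d: "0 < d" "\<And>h. \<lbrakk>0 < h; h < d\<rbrakk> \<Longrightarrow> x s < x (s + h)"
      using DERIV_pos_inc_right[OF dx[of s] vv] by auto
    \<comment> \<open>A point on the first arc so close to \<open>s\<close> that the positive slope
      there makes \<open>x a\<close> positive; halving \<open>d\<close> keeps the displacement
      strictly below \<open>d\<close>.\<close>
    define a where "a = s + min (d / 2) (t1 - s)"
    have a: "s < a" "a \<le> t1" using d t1' by (auto simp: a_def)
    have "0 < x a" using d(2)[of "min (d / 2) (t1 - s)"] d(1) t1' x0 by (auto simp: a_def)
    then obtain u where u: "a \<le> u" "u \<le> t1" "x u = 0"
      using IVT2'[of x t1 0 a] neg a cx by auto
    then show False
      using graph[of u] in1[of u] a t1' t2' by (auto simp: le_iff x_def)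
  qed
  moreover have "x t2 < 0"
  proof (rule ccontr)
    assume pos: "\<not> x t2 < 0"
    have "0 < inner (D s) (D (s + L))" using vv per by simp
    from DERIV_pos_inc_left[OF dx[of "s + L"] this]
    obtain d where d: "0 < d" "\<And>h. \<lbrakk>0 < h; h < d\<rbrakk> \<Longrightarrow> x (s + L - h) < x (s + L)"
      by auto
    define b where "b = s + L - min (d / 2) (s + L - t2)"
    have b: "t2 \<le> b" "b < s + L" using d t2' by (auto simp: b_def)
    have "x b < 0" using d(2)[of "min (d / 2) (s + L - t2)"] d(1) t2' x0 by (auto simp: b_def)
    then obtain u where u: "t2 \<le> u" "u \<le> b" "x u = 0"
      using IVT2'[of x b 0 t2] pos b cx by auto
    then show False
      using graph[of u] in2[of u] b t1' t2' by (auto simp: le_iff x_def)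
  qed
  ultimately show ?thesis
    using that[of t1 t2] set t1' t2' t0 by (auto simp: x_def)
qed

text \<open>The outside is connected and, being unbounded, not contained in \<open>\<Omega>\<close>.
  If it met \<open>\<Omega>\<close>, it would have to meet the frontier.\<close>

lemma outside_frontier_Int_empty:
  fixes \<Omega> :: "complex set"
  assumes "compact \<Omega>"
  shows "outside (frontier \<Omega>) \<inter> \<Omega> = {}"
proof (rule ccontr)
  assume ne: "outside (frontier \<Omega>) \<inter> \<Omega> \<noteq> {}"
  have b: "bounded \<Omega>" "bounded (frontier \<Omega>)"
    using assms by (auto simp: compact_imp_bounded compact_frontier)
  then have "\<not> outside (frontier \<Omega>) \<subseteq> \<Omega>"
    using unbounded_outside[OF b(2)] bounded_subset by blast
  moreover have "connected (outside (frontier \<Omega>))"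
    using b by (intro connected_outside) auto
  ultimately have "outside (frontier \<Omega>) \<inter> frontier \<Omega> \<noteq> {}"
    using ne by (intro connected_Int_frontier) auto
  then show False using outside_no_overlap by blast
qed

text \<open>Above \<open>h\<close>, and likewise below it, the half circle is free of frontier
  points, so membership in \<open>\<Omega>\<close> is inherited along the arc from the top or the
  bottom of the circle. The sign \<open>\<sigma>\<close> treats the right and the left half
  together.\<close>

lemma half_circle_membership:
  fixes \<Omega> :: "complex set" and p e :: complex and r h \<sigma> :: real
  assumes r: "0 < r" and \<sigma>: "\<bar>\<sigma>\<bar> = 1"
    and fr: "\<And>x y. \<lbrakk>x\<^sup>2 + y\<^sup>2 = r\<^sup>2; 0 \<le> \<sigma> * x; p + e * Complex x y \<in> frontier \<Omega>\<rbrakk> \<Longrightarrow> y = h"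
    and top: "p + e * Complex 0 r \<in> \<Omega>" and bot: "p + e * Complex 0 (- r) \<notin> \<Omega>"
    and y: "\<bar>y\<bar> < r"
  shows "h < y \<Longrightarrow> p + e * Complex (\<sigma> * sqrt (r\<^sup>2 - y\<^sup>2)) y \<in> \<Omega>"
    and "y < h \<Longrightarrow> p + e * Complex (\<sigma> * sqrt (r\<^sup>2 - y\<^sup>2)) y \<notin> \<Omega>"
proof -
  define c where "c y = p + e * Complex (\<sigma> * sqrt (r\<^sup>2 - y\<^sup>2)) y" for y
  have "continuous_on UNIV c"
    unfolding c_def Complex_eq by (intro continuous_intros)
  then have conn: "connected (c ` {a..b})" for a b
    by (intro connected_continuous_image) (auto intro: continuous_on_subset)
  have \<sigma>2: "\<sigma> * \<sigma> = 1" using \<sigma> by (metis abs_mult_self_eq mult_1)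
  have avoid: "u = h" if "\<bar>u\<bar> \<le> r" "c u \<in> frontier \<Omega>" for u
  proof (rule fr)
    have u: "u\<^sup>2 \<le> r\<^sup>2" using that abs_le_square_iff[of u r] r by simp
    show "(\<sigma> * sqrt (r\<^sup>2 - u\<^sup>2))\<^sup>2 + u\<^sup>2 = r\<^sup>2"
      using u \<sigma>2 by (simp add: power_mult_distrib power2_eq_square[of \<sigma>])
    show "0 \<le> \<sigma> * (\<sigma> * sqrt (r\<^sup>2 - u\<^sup>2))"
      using u \<sigma>2 by (simp flip: mult.assoc)
  qed (use that in \<open>simp add: c_def\<close>)
  have ends: "c r = p + e * Complex 0 r" "c (- r) = p + e * Complex 0 (- r)"
    by (simp_all add: c_def)
  show "p + e * Complex (\<sigma> * sqrt (r\<^sup>2 - y\<^sup>2)) y \<in> \<Omega>" if "h < y"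
  proof (rule ccontr)
    assume "\<not> ?thesis"
    then have "c y \<in> c ` {y..r} - \<Omega>" "c r \<in> c ` {y..r} \<inter> \<Omega>"
      using top y unfolding ends(1)[symmetric] c_def[of y, symmetric] by auto
    then have "c ` {y..r} \<inter> frontier \<Omega> \<noteq> {}"
      by (intro connected_Int_frontier[OF conn]) blast+
    then obtain u where "u \<in> {y..r}" "c u \<in> frontier \<Omega>" by blast
    then show False using avoid[of u] y that by (auto simp: abs_le_iff abs_less_iff)
  qed
  show "p + e * Complex (\<sigma> * sqrt (r\<^sup>2 - y\<^sup>2)) y \<notin> \<Omega>" if "y < h"
  proof
    assume "p + e * Complex (\<sigma> * sqrt (r\<^sup>2 - y\<^sup>2)) y \<in> \<Omega>"
    then have "c y \<in> c ` {- r..y} \<inter> \<Omega>" "c (- r) \<in> c ` {- r..y} - \<Omega>"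
      using bot y unfolding ends(2)[symmetric] c_def[of y, symmetric] by auto
    then have "c ` {- r..y} \<inter> frontier \<Omega> \<noteq> {}"
      by (intro connected_Int_frontier[OF conn]) blast+
    then obtain u where "u \<in> {- r..y}" "c u \<in> frontier \<Omega>" by blast
    then show False using avoid[of u] y that by (auto simp: abs_le_iff abs_less_iff)
  qed
qed

section \<open>Heights as sines of polar angles\<close>

lemma sin_angle_in:
  assumes "\<exists>!\<theta>. \<theta> \<in> I \<and> z = rcis (norm z) \<theta>"
  shows "norm z * sin (angle_in I z) = Im z"
proof -
  have "z = rcis (norm z) (angle_in I z)"
    unfolding angle_in_def using theI'[OF assms] by blast
  then show ?thesis by (metis Im_rcis)
qed

lemma sin_angle_in_right:
  assumes z: "0 < Re z"
  shows "norm z * sin (angle_in {- pi / 2 <..< pi / 2} z) = Im z"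
proof (rule sin_angle_in, rule ex1I)
  have "\<bar>Arg z\<bar> < pi / 2" using z Arg_Re_pos[of z] by simp
  then show "Arg z \<in> {- pi / 2 <..< pi / 2} \<and> z = rcis (norm z) (Arg z)"
    by (auto simp: rcis_cmod_Arg)
  fix \<theta> assume \<theta>: "\<theta> \<in> {- pi / 2 <..< pi / 2} \<and> z = rcis (norm z) \<theta>"
  have "0 < norm z" using z by auto
  moreover have "\<theta> \<in> {- pi<..pi}" using \<theta> pi_gt_zero by auto
  ultimately show "\<theta> = Arg z" using Arg_unique'[of "norm z" \<theta> z] \<theta> by simp
qed

text \<open>The principal argument jumps on the negative real axis, inside this sector. Passing to
  \<open>- z\<close> and adding \<open>pi\<close> avoids the jump.\<close>

lemma sin_angle_in_left:
  assumes z: "Re z < 0"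
  shows "norm z * sin (angle_in {pi / 2 <..< 3 * pi / 2} z) = Im z"
proof (rule sin_angle_in, rule ex1I)
  have rcis_shift: "rcis a (\<theta> + pi) = - rcis a \<theta>" for a \<theta>
    by (simp add: rcis_def cis.ctr complex_eq_iff)
  have "\<bar>Arg (- z)\<bar> < pi / 2" using z Arg_Re_pos[of "- z"] by simp
  moreover have "rcis (norm z) (Arg (- z) + pi) = z"
    using rcis_cmod_Arg[of "- z"] by (simp add: rcis_shift)
  ultimately show "Arg (- z) + pi \<in> {pi / 2 <..< 3 * pi / 2} \<and> z = rcis (norm z) (Arg (- z) + pi)"
    by auto
  fix \<theta> assume \<theta>: "\<theta> \<in> {pi / 2 <..< 3 * pi / 2} \<and> z = rcis (norm z) \<theta>"
  have "0 < norm z" using z by auto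
  moreover have "\<theta> - pi \<in> {- pi<..pi}" using \<theta> pi_gt_zero by auto
  moreover have "- z = rcis (norm z) (\<theta> - pi)"
    using rcis_shift[of "norm z" "\<theta> - pi"] \<theta> by (metis add.inverse_inverse diff_add_cancel)
  ultimately show "\<theta> = Arg (- z) + pi" using Arg_unique'[of "norm z" "\<theta> - pi" "- z"] by simp
qed

section \<open>The periodic extension, its velocity and the tangent frame\<close>

lemma periodic_ext_add_period:
  assumes "0 < L"
  shows "periodic_ext L \<gamma> (t + L) = periodic_ext L \<gamma> t"
  using assms by (simp add: periodic_ext_def add_divide_distrib frac_1_eq)

lemma periodic_ext_eq:
  assumes "0 < L" "\<gamma> 0 = \<gamma> L" "t \<in> {0..L}"
  shows "periodic_ext L \<gamma> t = \<gamma> t"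
proof (cases "t = L")
  case False
  then have "frac (t / L) = t / L" using assms by (intro frac_eq_id) auto
  then show ?thesis using assms by (simp add: periodic_ext_def)
qed (use assms in \<open>simp add: periodic_ext_def\<close>)

lemma velocity_C1:
  assumes "periodic_ext L \<gamma> C1_differentiable_on UNIV"
  shows "(periodic_ext L \<gamma> has_vector_derivative velocity L \<gamma> t) (at t)"
    and "continuous_on UNIV (velocity L \<gamma>)"
  using assms unfolding C1_differentiable_on_eq velocity_def
  by (simp_all add: vector_derivative_works flip: velocity_def)

lemma velocity_add_period:
  assumes L: "0 < L" and C1: "periodic_ext L \<gamma> C1_differentiable_on UNIV"
  shows "velocity L \<gamma> (t + L) = velocity L \<gamma> t"
proof (rule vector_derivative_unique_at)
  have "((\<lambda>t. t + L) has_vector_derivative 1) (at t)"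
    by (auto intro!: derivative_eq_intros)
  then have "(periodic_ext L \<gamma> \<circ> (\<lambda>t. t + L) has_vector_derivative 1 *\<^sub>R velocity L \<gamma> (t + L)) (at t)"
    by (rule vector_diff_chain_at) (rule velocity_C1(1)[OF C1])
  moreover have "periodic_ext L \<gamma> \<circ> (\<lambda>t. t + L) = periodic_ext L \<gamma>"
    unfolding o_def by (intro ext periodic_ext_add_period[OF L])
  ultimately show "(periodic_ext L \<gamma> has_vector_derivative velocity L \<gamma> (t + L)) (at t)"
    by simp
  show "(periodic_ext L \<gamma> has_vector_derivative velocity L \<gamma> t) (at t)"
    by (rule velocity_C1(1)[OF C1])
qed

text \<open>For a continuously differentiable curve both one-sided limits of the velocity are the
  velocity itself, so the coefficients 1 and 0 produce it.\<close>

lemma velocity_in_tangent_cone: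
  assumes C1: "periodic_ext L \<gamma> C1_differentiable_on UNIV"
  shows "velocity L \<gamma> t \<in> tangent_cone L \<gamma> t"
proof -
  have "isCont (velocity L \<gamma>) t"
    using velocity_C1(2)[OF C1] by (simp add: continuous_on_eq_continuous_at)
  then have "(velocity L \<gamma> \<longlongrightarrow> velocity L \<gamma> t) (at_left t)"
    by (simp add: isCont_def filterlim_at_split)
  then have "Lim (at_left t) (velocity L \<gamma>) = velocity L \<gamma> t"
    by (intro tendsto_Lim) auto
  then have "velocity L \<gamma> t = 1 *\<^sub>R Lim (at_left t) (velocity L \<gamma>) + 0 *\<^sub>R Lim (at_right t) (velocity L \<gamma>)"
    by simp
  then show ?thesis
    unfolding tangent_cone_def by (intro CollectI exI[of _ 1] exI[of _ 0]) auto
qed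

text \<open>Near \<open>s\<close> the second coordinate of the curve is \<open>f\<close> of the
  first, so \<open>f'(0) = 0\<close> and the chain rule leave the velocity without a vertical
  component. The sign is a matter of orientation and remains open here.\<close>

lemma tangential_frame_velocity:
  assumes c: "(c has_vector_derivative v) (at s)" and cs: "c s = p" and v: "norm v = 1" and r: "0 < r"
    and range: "range c \<subseteq> frontier \<Omega>"
    and e: "tangential_frame \<Omega> p r e"
  shows "v = e \<or> v = - e"
proof -
  obtain X f where f: "f 0 = 0" "(f has_real_derivative 0) (at 0)"
    "coords p e ` (frontier \<Omega> \<inter> cball p r) = {Complex x (f x) | x. x \<in> X}" and e1: "norm e = 1"
    using e unfolding tangential_frame_def by blast
  have e0: "e \<noteq> 0" using e1 by auto
  have "((\<lambda>t. coords p e (c t)) has_vector_derivative v / e) (at s)"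
    unfolding coords_def using c e0
    by (auto simp: divide_inverse intro!: derivative_eq_intros)
  note dc = this
  have dRe: "((\<lambda>t. Re (coords p e (c t))) has_real_derivative Re (v / e)) (at s)"
    and dIm: "((\<lambda>t. Im (coords p e (c t))) has_real_derivative Im (v / e)) (at s)"
    unfolding has_real_derivative_iff_has_vector_derivative
    by (rule bounded_linear.has_vector_derivative[OF bounded_linear_Re dc]
        bounded_linear.has_vector_derivative[OF bounded_linear_Im dc])+
  have "Re (coords p e (c s)) = 0" by (simp add: coords_def cs)
  then have "((\<lambda>t. f (Re (coords p e (c t)))) has_real_derivative 0 * Re (v / e)) (at s)"
    using f(2) dRe by (intro DERIV_chain2) auto
  moreover have "\<forall>\<^sub>F t in nhds s. f (Re (coords p e (c t))) = Im (coords p e (c t))"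
  proof -
    have "isCont c s" using c by (rule has_vector_derivative_continuous)
    then have "(c \<longlongrightarrow> c s) (nhds s)"
      unfolding isCont_def tendsto_at_iff_tendsto_nhds .
    then have "\<forall>\<^sub>F t in nhds s. c t \<in> ball p r"
      by (rule topological_tendstoD) (use r cs in auto)
    then show ?thesis
    proof eventually_elim
      case (elim t)
      then have "coords p e (c t) \<in> coords p e ` (frontier \<Omega> \<inter> cball p r)"
        using range by (intro imageI) (auto simp: less_imp_le)
      then show ?case unfolding f(3) by auto
    qed
  qed
  ultimately have "((\<lambda>t. Im (coords p e (c t))) has_real_derivative 0) (at s)"
    by (subst (asm) DERIV_cong_ev[OF refl _ refl]) auto
  then have "Im (v / e) = 0" using dIm DERIV_unique by blast
  moreover have "norm (v / e) = 1" by (simp add: norm_divide v e1)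
  ultimately have "v / e = 1 \<or> v / e = - 1"
    by (auto simp: complex_eq_iff cmod_def abs_if split: if_splits)
  then show ?thesis using e0 by (auto simp: field_simps)
qed

subsection \<open>The derivative of the area\<close>

theorem lemma4p4p2:
  fixes \<Omega> :: "complex set" and \<gamma> :: "real \<Rightarrow> complex" and L r s :: real and e :: complex
  assumes "arclength_boundary \<Omega> L \<gamma>"
    and "r > 0"
    and "tangent_cone_graph_like \<Omega> L \<gamma> r"
    and "s \<in> {0..<L}"
    and "tangentially_graph_like \<Omega> L \<gamma> (\<gamma> s) r"
    and "tangential_frame \<Omega> (\<gamma> s) r e"
  shows "((\<lambda>t. disk_area \<Omega> L \<gamma> t r) has_real_derivative
            left_height \<Omega> (\<gamma> s) r e - right_height \<Omega> (\<gamma> s) r e) (at s) \<and>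
         left_height \<Omega> (\<gamma> s) r e - right_height \<Omega> (\<gamma> s) r e =
            r * sin (left_angle \<Omega> (\<gamma> s) r e) - r * sin (right_angle \<Omega> (\<gamma> s) r e)"
proof -
  define G where "G = periodic_ext L \<gamma>"
  define D where "D = velocity L \<gamma>"
  define p where "p = \<gamma> s"
  define F where "F = frontier \<Omega>"
  note r = assms(2) and s = assms(4) and frame = assms(6)[folded p_def]
  have L: "0 < L" and \<Omega>: "compact \<Omega>" and Fr: "F = \<gamma> ` {0..L}" and closed: "\<gamma> 0 = \<gamma> L"
    and simple: "simple_path (\<lambda>t. \<gamma> (L * t))"
    and speed: "\<And>t v. t \<in> {0..L} \<Longrightarrow> (\<gamma> has_vector_derivative v) (at t within {0..L}) \<Longrightarrow> norm v = 1"
    and wn: "\<And>z. z \<in> inside F \<Longrightarrow> winding_number (\<lambda>t. \<gamma> (L * t)) z = 1"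
    using assms(1) unfolding arclength_boundary_def piecewise_C1_closed_curve_def F_def by blast+
  have C1: "periodic_ext L \<gamma> C1_differentiable_on UNIV"
    using assms(5) by (simp add: tangentially_graph_like_def)
  have dG: "(G has_vector_derivative D t) (at t)" for t
    unfolding G_def D_def by (rule velocity_C1(1)[OF C1])
  have cD: "continuous_on UNIV D"
    unfolding D_def by (rule velocity_C1(2)[OF C1])
  have per: "G (t + L) = G t" "D (t + L) = D t" for t
    unfolding G_def D_def by (rule periodic_ext_add_period[OF L] velocity_add_period[OF L C1])+
  have G\<gamma>: "G t = \<gamma> t" if "t \<in> {0..L}" for t
    unfolding G_def by (rule periodic_ext_eq[of L \<gamma>, OF L closed that])
  have s': "s \<in> {0..L}" using s by simp
  have Gs: "G s = p" using G\<gamma>[OF s'] by (simp add: p_def)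
  have normD: "norm (D s) = 1"
  proof (rule speed[OF s'])
    have "(G has_vector_derivative D s) (at s within {0..L})"
      using dG by (rule has_vector_derivative_at_within)
    then show "(\<gamma> has_vector_derivative D s) (at s within {0..L})"
      by (rule has_vector_derivative_transform[rotated 2]) (use s' G\<gamma> in auto)
  qed
  \<comment> \<open>The hypotheses concern parameters from 0 to \<open>L\<close>, whereas the curve
    is followed over the period that starts at \<open>s\<close>.\<close>
  have wrap: "\<exists>u\<in>{0..L}. G u = G t \<and> D u = D t \<and> (u = t \<or> u = t - L)" if "t \<in> {s..s + L}" for t
  proof (cases "t \<le> L")
    case False
    then have "t - L \<in> {0..L}" using that s by auto
    then show ?thesis using per[of "t - L"] by auto
  qed (use that s in auto)
  have F_s: "F = G ` {s..s + L}"
  proof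
    show "F \<subseteq> G ` {s..s + L}"
    proof
      fix q assume "q \<in> F"
      then obtain t where t: "t \<in> {0..L}" "q = G t" using Fr G\<gamma> by auto
      show "q \<in> G ` {s..s + L}"
      proof (cases "s \<le> t")
        case False
        then have "t + L \<in> {s..s + L}" using t s by auto
        then show ?thesis using t per[of t] by (metis imageI)
      qed (use t s in auto)
    qed
    show "G ` {s..s + L} \<subseteq> F"
    proof
      fix q assume "q \<in> G ` {s..s + L}"
      then obtain t where t: "t \<in> {s..s + L}" "q = G t" by blast
      from wrap[OF t(1)] obtain u where "u \<in> {0..L}" "G u = G t" by blast
      then show "q \<in> F" using G\<gamma>[of u] t(2) unfolding Fr by (metis imageI)
    qed
  qed
  have inj0: "t = s \<or> t = s + L" if t: "t \<in> {0..L}" "G t = G s" for t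
  proof -
    have "\<gamma> (L * (t / L)) = \<gamma> (L * (s / L))" using t G\<gamma>[OF t(1)] G\<gamma>[OF s'] L by simp
    moreover have "t / L \<in> {0..1}" "s / L \<in> {0..1}" using t s L by auto
    ultimately have "t / L = s / L \<or> t / L = 0 \<and> s / L = 1 \<or> t / L = 1 \<and> s / L = 0"
      using simple unfolding simple_path_def loop_free_def by blast
    then show ?thesis using L s by auto
  qed
  have inj: "G t \<noteq> G s" if t: "t \<in> {s<..<s + L}" for t
  proof
    assume eq: "G t = G s"
    have "t \<in> {s..s + L}" using t by simp
    from wrap[OF this] obtain u where u: "u \<in> {0..L}" "G u = G t" "u = t \<or> u = t - L" by blast
    then have "u = s \<or> u = s + L" using inj0[of u] eq by simp
    then show False using t u(3) by auto
  qed
  \<comment> \<open>The case \<open>u = t\<close> is transversality of the curve to circles about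
    \<open>p\<close>; the case \<open>u = s\<close> says that the curve does not cross the normal at
    \<open>p\<close> again. Both points lie in the disk about either of them.\<close>
  have cone: "inner (D u) (G t - G s) \<noteq> 0"
    if t: "t \<in> {s<..<s + L}" "dist (G s) (G t) \<le> r" "u = s \<or> u = t" for t u
  proof -
    have t': "t \<in> {s..s + L}" using t by simp
    obtain u' where u': "u' \<in> {0..L}" "G u' = G u" "D u' = D u"
      using wrap[OF t'] s' t(3) by metis
    have "D u' \<in> tangent_cone L \<gamma> u'"
      unfolding D_def by (rule velocity_in_tangent_cone[OF C1])
    moreover have "G t \<in> frontier \<Omega>" "G s \<in> frontier \<Omega>"
      using F_s t' L by (auto simp: F_def)
    moreover have "G t \<in> cball (\<gamma> u') r" "G s \<in> cball (\<gamma> u') r"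
      using t(2,3) r u' G\<gamma>[OF u'(1)] by (auto simp: dist_commute)
    ultimately show ?thesis
      using assms(3) u' inj[OF t(1)] unfolding tangent_cone_graph_like_def by force
  qed
  obtain t1 t2 where t12: "t1 \<in> {s<..<s + L}" "t2 \<in> {s<..<s + L}"
    "{t \<in> {s..s + L}. dist (G s) (G t) = r} = {t1, t2}"
    "0 < inner (D s) (G t1 - G s)" "inner (D s) (G t2 - G s) < 0"
  proof (rule two_sphere_crossings[OF L r dG per[of s] inj])
    show "D s \<noteq> 0" using normD by auto
  qed (use cone in auto)
  have e1: "norm e = 1" and e0: "e \<noteq> 0"
    using frame by (auto simp: tangential_frame_def)
  have De: "D s = e \<or> D s = - e"
  proof (rule tangential_frame_velocity[OF dG Gs normD r _ frame])
    have "G t \<in> F" for t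
      unfolding Fr G_def periodic_ext_def
      using L frac_ge_0[of "t / L"] frac_lt_1[of "t / L"]
      by (intro imageI) (auto simp: mult_le_cancel_left1 intro: less_imp_le)
    then show "range G \<subseteq> frontier \<Omega>" by (auto simp: F_def)
  qed
  \<comment> \<open>Inside the disk the y-axis meets the boundary at the origin only. Both the
    choice of test points beside the curve and the position of the two poles of the circle rest on
    this.\<close>
  have on_axis: "q = p" if q: "q \<in> F" "q \<in> cball p r" "inner e (q - p) = 0" for q
  proof (rule ccontr)
    assume ne: "q \<noteq> p"
    obtain t where t: "t \<in> {s..s + L}" "q = G t" using q(1) F_s by auto
    then have "t \<in> {s<..<s + L}" using ne Gs per[of s] by (cases "t = s"; cases "t = s + L") auto
    from cone[OF this, of s] q t Gs De show False by (auto simp: inner_minus_left)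
  qed
  have inner_axis: "inner e (q - p) = Re (coords p e q)" for q
  proof -
    have "Re ((q - p) / e) = Re ((q - p) * cnj e)"
      using e1 by (simp add: complex_div_cnj[of "q - p" e])
    then show ?thesis by (simp add: coords_def inner_complex_def mult.commute)
  qed
  have pathF: "path_image (\<lambda>x. G (L * x)) = F"
  proof -
    have "path_image (\<lambda>x. G (L * x)) = G ` ((*) L ` {0..1})"
      by (auto simp: path_image_def)
    also have "(*) L ` {0..1} = {0..L}"
      using L by (simp add: image_mult_atLeastAtMost)
    also have "G ` {0..L} = \<gamma> ` {0..L}"
      by (rule image_cong[OF refl G\<gamma>])
    finally show ?thesis unfolding Fr .
  qed
  define W where "W = winding_number (\<lambda>x. G (L * x))"
  have W: "W z = winding_number (\<lambda>t. \<gamma> (L * t)) z" for z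
    unfolding W_def by (rule winding_number_cong) (use L in \<open>auto intro!: G\<gamma> simp: mult_le_cancel_left1\<close>)
  have W_out: "W z = 0" if "z \<in> outside F" for z
    unfolding W
  proof (rule winding_number_zero_in_outside)
    show "path (\<lambda>t. \<gamma> (L * t))" using simple by (rule simple_path_imp_path)
    show "pathfinish (\<lambda>t. \<gamma> (L * t)) = pathstart (\<lambda>t. \<gamma> (L * t))"
      using closed by (simp add: pathfinish_def pathstart_def)
    have "path_image (\<lambda>t. \<gamma> (L * t)) = path_image (\<lambda>x. G (L * x))"
      using L unfolding path_image_def by (intro image_cong) (auto intro!: G\<gamma>[symmetric] simp: mult_le_cancel_left1)
    then show "z \<in> outside (path_image (\<lambda>t. \<gamma> (L * t)))" using that pathF by simp
  qed
  have out_\<Omega>: "z \<notin> \<Omega>" if "z \<in> outside F" for z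
    using outside_frontier_Int_empty[OF \<Omega>] that by (auto simp: F_def)
  have dist_frame: "dist p (p + e * z) = norm z" for z
    by (simp add: dist_norm norm_mult e1)
  have axis_notin: "p + e * Complex 0 y \<notin> F" if "0 < \<bar>y\<bar>" "\<bar>y\<bar> \<le> r" for y
  proof
    assume "p + e * Complex 0 y \<in> F"
    moreover have "dist p (p + e * Complex 0 y) = \<bar>y\<bar>"
      unfolding dist_frame by (simp add: cmod_def)
    moreover have "inner e (p + e * Complex 0 y - p) = 0"
      unfolding inner_axis using e0 by (simp add: coords_def)
    ultimately have "p + e * Complex 0 y = p" using that by (intro on_axis) auto
    then show False using e0 that by (simp add: complex_eq_iff)
  qed
  \<comment> \<open>Three conditions that hold for all small positive \<open>\<epsilon>\<close> are
    combined so that a single value can be picked.\<close>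
  have "\<forall>\<^sub>F \<epsilon> in at_right 0. \<exists>q\<in>\<Omega>. coords p e q = Complex 0 \<epsilon>"
    using frame by (simp add: tangential_frame_def)
  moreover have "\<forall>\<^sub>F \<epsilon> in at_right 0. G s + \<i> * of_real \<epsilon> * D s \<notin> F \<longrightarrow> G s - \<i> * of_real \<epsilon> * D s \<notin> F \<longrightarrow>
      Re (W (G s - \<i> * of_real \<epsilon> * D s)) < Re (W (G s + \<i> * of_real \<epsilon> * D s))"
    using winding_number_jump[OF L s dG cD per inj0 normD] unfolding pathF W_def .
  moreover have "\<forall>\<^sub>F \<epsilon> in at_right 0. 0 < \<epsilon> \<and> \<epsilon> < r"
    using r by (auto simp: eventually_at_right_field)
  ultimately have "\<forall>\<^sub>F \<epsilon> in at_right 0. 0 < \<epsilon> \<and> \<epsilon> < r \<and> (\<exists>q\<in>\<Omega>. coords p e q = Complex 0 \<epsilon>) \<and>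
      (G s + \<i> * of_real \<epsilon> * D s \<notin> F \<longrightarrow> G s - \<i> * of_real \<epsilon> * D s \<notin> F \<longrightarrow>
      Re (W (G s - \<i> * of_real \<epsilon> * D s)) < Re (W (G s + \<i> * of_real \<epsilon> * D s)))"
    by eventually_elim blast
  then obtain \<epsilon> where \<epsilon>: "0 < \<epsilon>" "\<epsilon> < r" and up: "\<exists>q\<in>\<Omega>. coords p e q = Complex 0 \<epsilon>"
    and jump: "G s + \<i> * of_real \<epsilon> * D s \<notin> F \<longrightarrow> G s - \<i> * of_real \<epsilon> * D s \<notin> F \<longrightarrow>
      Re (W (G s - \<i> * of_real \<epsilon> * D s)) < Re (W (G s + \<i> * of_real \<epsilon> * D s))"
    using eventually_happens'[OF trivial_limit_at_right_real] by blast
  define zu zd where "zu = p + e * Complex 0 \<epsilon>" and "zd = p + e * Complex 0 (- \<epsilon>)"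
  have zu\<Omega>: "zu \<in> \<Omega>"
  proof -
    obtain q where q: "q \<in> \<Omega>" "(q - p) / e = Complex 0 \<epsilon>" using up by (auto simp: coords_def)
    then have "q = zu" using e0 by (simp add: zu_def field_simps)
    with q show ?thesis by simp
  qed
  have zF: "zu \<notin> F" "zd \<notin> F" using axis_notin[of \<epsilon>] axis_notin[of "- \<epsilon>"] \<epsilon> by (auto simp: zu_def zd_def)
  have zz: "p + \<i> * of_real \<epsilon> * e = zu" "p - \<i> * of_real \<epsilon> * e = zd"
    by (auto simp: zu_def zd_def complex_eq_iff)
  \<comment> \<open>\<open>zu\<close> lies in \<open>\<Omega>\<close> and off the boundary, and the
    outside of the boundary misses \<open>\<Omega>\<close>.\<close>
  have zu_in: "zu \<in> inside F"
    using zF out_\<Omega>[of zu] zu\<Omega> inside_Un_outside[of F] by blast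
  then have Wu: "W zu = 1" using wn W by simp
  have Wd: "W zd = 1 \<and> zd \<in> inside F \<or> W zd = 0 \<and> zd \<in> outside F"
  proof -
    have "zd \<in> inside F \<or> zd \<in> outside F" using zF(2) inside_Un_outside[of F] by blast
    then show ?thesis using wn[of zd] W[of zd] W_out[of zd] by metis
  qed
  \<comment> \<open>With \<open>D s = - e\<close> the left side of the curve at \<open>p\<close>
    would be below, and the jump would make \<open>W zd\<close> larger than \<open>W zu = 1\<close>,
    although it is 0 or 1.\<close>
  have Ds: "D s = e"
  proof (rule ccontr)
    assume "D s \<noteq> e"
    then have "D s = - e" using De by simp
    then have "Re (W zu) < Re (W zd)"
      using jump zF zz by (simp add: Gs)
    then show False using Wu Wd by auto
  qed
  \<comment> \<open>Now the jump reads \<open>W zd < 1\<close>, which leaves only the value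
    0.\<close>
  have zd_out: "zd \<in> outside F"
    using jump zF zz Wu Wd by (auto simp: Gs Ds)
  define axis where "axis y = p + e * Complex 0 y" for y
  have axis_connected: "connected (axis ` {u..v})" for u v
    unfolding axis_def Complex_eq by (intro connected_continuous_image continuous_intros) auto
  have axis_F: "y = 0" if "axis y \<in> frontier \<Omega>" "\<bar>y\<bar> \<le> r" for y
    using axis_notin[of y] that by (auto simp: axis_def F_def)
  \<comment> \<open>The axis runs from \<open>zu\<close> up to height \<open>r\<close> without
    meeting the frontier, so the top of the circle lies in \<open>\<Omega>\<close> with
    \<open>zu\<close>. In the same way the bottom is outside \<open>\<Omega>\<close> with
    \<open>zd\<close>.\<close>
  have top: "p + e * Complex 0 r \<in> \<Omega>"
  proof (rule ccontr)
    assume "p + e * Complex 0 r \<notin> \<Omega>"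
    then have "axis r \<in> axis ` {\<epsilon>..r} - \<Omega>" "axis \<epsilon> \<in> axis ` {\<epsilon>..r} \<inter> \<Omega>"
      using zu\<Omega> \<epsilon> unfolding zu_def axis_def[symmetric] by auto
    then have "axis ` {\<epsilon>..r} \<inter> frontier \<Omega> \<noteq> {}"
      by (intro connected_Int_frontier[OF axis_connected]) blast+
    then obtain y where "y \<in> {\<epsilon>..r}" "axis y \<in> frontier \<Omega>" by blast
    then show False using axis_F[of y] \<epsilon> by auto
  qed
  have bot: "p + e * Complex 0 (- r) \<notin> \<Omega>"
  proof
    assume "p + e * Complex 0 (- r) \<in> \<Omega>"
    then have "axis (- r) \<in> axis ` {- r..- \<epsilon>} \<inter> \<Omega>" "axis (- \<epsilon>) \<in> axis ` {- r..- \<epsilon>} - \<Omega>"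
      using out_\<Omega>[OF zd_out] \<epsilon> unfolding zd_def axis_def[symmetric] by auto
    then have "axis ` {- r..- \<epsilon>} \<inter> frontier \<Omega> \<noteq> {}"
      by (intro connected_Int_frontier[OF axis_connected]) blast+
    then obtain y where "y \<in> {- r..- \<epsilon>}" "axis y \<in> frontier \<Omega>" by blast
    then show False using axis_F[of y] \<epsilon> by auto
  qed
  define a b where "a = G t1" and "b = G t2"
  have sphere: "F \<inter> sphere p r = {a, b}"
  proof -
    have "F \<inter> sphere p r = G ` {t \<in> {s..s + L}. dist (G s) (G t) = r}"
      unfolding F_s Gs by auto
    then show ?thesis unfolding t12(3) by (simp add: a_def b_def)
  qed
  have a_pos: "0 < Re (coords p e a)" and b_neg: "Re (coords p e b) < 0"
    using t12(4,5) unfolding Gs Ds inner_axis by (simp_all add: a_def b_def)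
  have right: "right_point \<Omega> p r e = a" and left: "left_point \<Omega> p r e = b"
    unfolding right_point_def left_point_def F_def[symmetric] sphere
    using a_pos b_neg by (auto intro!: the_equality)
  define h1 h2 where "h1 = right_height \<Omega> p r e" and "h2 = left_height \<Omega> p r e"
  have h12: "h1 = Im (coords p e a)" "h2 = Im (coords p e b)"
    by (simp_all add: h1_def h2_def right_height_def left_height_def right left)
  have norm_coords: "norm (coords p e q) = dist p q" for q
    by (simp add: coords_def norm_divide e1 dist_norm norm_minus_commute)
  have n_ab: "norm (coords p e a) = r" "norm (coords p e b) = r"
    using sphere by (auto simp: norm_coords)
  have Im_lt: "\<bar>Im z\<bar> < norm z" if "Re z \<noteq> 0" for z
    by (rule power2_less_imp_less) (use that in \<open>simp_all add: cmod_power2\<close>)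
  have h_lt: "\<bar>h1\<bar> < r" "\<bar>h2\<bar> < r"
    using Im_lt[of "coords p e a"] Im_lt[of "coords p e b"] a_pos b_neg n_ab h12 by auto
  have angles: "h2 - h1 = r * sin (left_angle \<Omega> p r e) - r * sin (right_angle \<Omega> p r e)"
    using sin_angle_in_right[OF a_pos] sin_angle_in_left[OF b_neg] n_ab
    by (simp add: right_angle_def left_angle_def right left h12)
  have circle: "Complex x y = coords p e a \<or> Complex x y = coords p e b"
    if "x\<^sup>2 + y\<^sup>2 = r\<^sup>2" "p + e * Complex x y \<in> F" for x y
  proof -
    have "dist p (p + e * Complex x y) = r"
      unfolding dist_frame using that(1) r by (simp add: cmod_def)
    then have "p + e * Complex x y \<in> F \<inter> sphere p r"
      using that(2) unfolding Int_iff mem_sphere by blast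
    then have "p + e * Complex x y = a \<or> p + e * Complex x y = b"
      unfolding sphere by blast
    moreover have "coords p e (p + e * Complex x y) = Complex x y"
      using e0 by (simp add: coords_def)
    ultimately show ?thesis by metis
  qed
  \<comment> \<open>The weak inequality lets the half circle include both poles; \<open>b\<close> is
    still excluded, since its first coordinate is strictly negative.\<close>
  have fr_r: "y = h1" if "x\<^sup>2 + y\<^sup>2 = r\<^sup>2" "0 \<le> 1 * x" "p + e * Complex x y \<in> frontier \<Omega>" for x y
    using circle[OF that(1)] that b_neg h12 unfolding F_def by (metis complex.sel mult_1 not_le)
  have fr_l: "y = h2" if "x\<^sup>2 + y\<^sup>2 = r\<^sup>2" "0 \<le> (- 1) * x" "p + e * Complex x y \<in> frontier \<Omega>" for x y
    using circle[OF that(1)] that a_pos h12 unfolding F_def by (metis complex.sel mult_minus1 neg_0_le_iff_le not_le)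
  define fr fl where "fr y = (indicator \<Omega> (p + e * Complex (sqrt (r\<^sup>2 - y\<^sup>2)) y) :: real)"
    and "fl y = (indicator \<Omega> (p + e * Complex (- sqrt (r\<^sup>2 - y\<^sup>2)) y) :: real)" for y
  have "((\<lambda>h. measure lborel (\<Omega> \<inter> cball (p + of_real h * e) r)) has_real_derivative
      (LINT y|lborel. indicator {-r<..<r} y * (fr y - fl y))) (at 0)"
    unfolding fr_def fl_def
  proof (rule disc_area_directional_deriv[OF \<Omega> e1 r, of "{h1, h2}"])
    fix x y assume "y \<notin> {h1, h2}" "x\<^sup>2 + y\<^sup>2 = r\<^sup>2"
    then show "p + e * Complex x y \<notin> frontier \<Omega>"
      using fr_r[of x y] fr_l[of x y] by (cases "0 \<le> x") auto
  qed auto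
  also have "(LINT y|lborel. indicator {-r<..<r} y * (fr y - fl y)) = h2 - h1"
  proof (rule integral_step_difference[OF h_lt])
    have "closed \<Omega>" using \<Omega> by (rule compact_imp_closed)
    then have ind: "(indicator \<Omega> :: complex \<Rightarrow> real) \<in> borel_measurable borel"
      by (intro borel_measurable_indicator borel_closed)
    have "(\<lambda>y. p + e * Complex (sqrt (r\<^sup>2 - y\<^sup>2)) y) \<in> borel_measurable borel"
      "(\<lambda>y. p + e * Complex (- sqrt (r\<^sup>2 - y\<^sup>2)) y) \<in> borel_measurable borel"
      unfolding Complex_eq by (intro borel_measurable_continuous_onI continuous_intros)+
    from this[THEN measurable_compose, OF ind]
    show "fr \<in> borel_measurable borel" "fl \<in> borel_measurable borel"
      by (simp_all add: fr_def[abs_def] fl_def[abs_def])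
    fix y assume y: "\<bar>y\<bar> < r"
    show "h1 < y \<Longrightarrow> fr y = 1" "y < h1 \<Longrightarrow> fr y = 0"
      using half_circle_membership[where \<sigma> = 1, OF r _ fr_r top bot y] by (auto simp: fr_def)
    show "h2 < y \<Longrightarrow> fl y = 1" "y < h2 \<Longrightarrow> fl y = 0"
      using half_circle_membership[where \<sigma> = "- 1", OF r _ fr_l top bot y] by (auto simp: fl_def)
  qed
  finally have "((\<lambda>t. measure lborel (\<Omega> \<inter> cball (G t) r)) has_real_derivative h2 - h1) (at s)"
    using disc_area_curve_deriv[OF \<Omega> r dG[of s]] by (simp add: Gs Ds)
  \<comment> \<open>Compact sets are Borel, so the completed measure in \<open>disk_area\<close>
    agrees with \<open>lborel\<close> on them.\<close>
  moreover have "disk_area \<Omega> L \<gamma> t r = measure lborel (\<Omega> \<inter> cball (G t) r)" for t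
    unfolding disk_area_def G_def using \<Omega> by (intro measure_completion) (auto intro!: borel_compact compact_Int)
  ultimately show ?thesis
    using angles by (simp add: h1_def h2_def p_def)
qed

end
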